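(* Let $r\ge 3$ be an integer, $d>0$ a real number, $(d_n)_{n\in\mathbb{N}}$ a sequence of reals with $d_n\to d$, and $p=p(n)=d_n/\binom{n-1}{r-1}$. Let $L_C$ be the length of the longest loose cycle in $H=H^r(n,p)$. Then with high probability $$L_C\le \left(\min\{\beta,\gamma\}+o(1)\right)\cdot n,$$ where, with $\rho_*$ and $\hat\rho_*$ as defined in the context, $$\beta=\frac{d}{r}\left(1-(1-\rho_* )^r-r\rho_*(1-\rho_* )^{r-1}\right),\qquad \gamma=1-\exp(-d\hat\rho_* )-d\hat\rho_*\exp(-d\hat\rho_* ).$$
   Context: Asymptotics are as $n\to\infty$; "with high probability" means with probability tending to $1$ as $n\to\infty$. $H^r(n,p)$ is the random $r$-uniform hypergraph on vertex set $[n]$ in which each $r$-subset of $[n]$ is an edge independently with probability $p$. A loose path of length $\ell$ in an $r$-uniform hypergraph is a sequence of distinct vertices $v_1,\dots,v_{\ell(r-1)+1}$ and a sequence of edges $e_1,\dots,e_\ell$ with $e_i=\{v_{(i-1)(r-1)+1},\dots,v_{(i-1)(r-1)+r}\}$ for $i\in[\ell]$. A loose cycle of length $\ell$ is defined similarly, except that $v_{\ell(r-1)+1}=v_1$ (and otherwise all vertices are distinct). Let $F(x)=\exp(-d(1-x^{r-1}))$ for $x\ge 0$; $\rho_*=\rho_*(r,d)$ is the largest solution $\rho$ of $1-\rho=F(1-\rho)$ (note $\rho=0$ is always a solution), and $\hat\rho_*=1-(1-\rho_* )^{r-1}$. *)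

theory Defs
  imports "HOL-Probability.Probability"
begin

definition all_edges :: "nat \<Rightarrow> nat \<Rightarrow> nat set set" where
  "all_edges r n = {e. e \<subseteq> {1..n} \<and> card e = r}"

text \<open>
  The random hypergraph is given by its edge set, on the vertex set \<open>{1..n}\<close>.
  \<^const>\<open>bernoulli_pmf\<close> truncates its parameter to the unit interval, so this is
  defined for every real \<open>p\<close>.
\<close>

definition random_hypergraph :: "nat \<Rightarrow> nat \<Rightarrow> real \<Rightarrow> nat set set pmf" where
  "random_hypergraph r n p =
     map_pmf (\<lambda>f. {e \<in> all_edges r n. f e})
       (Pi_pmf (all_edges r n) False (\<lambda>_. bernoulli_pmf p))"

definition loose_cycle ::
  "nat \<Rightarrow> 'a set \<Rightarrow> 'a set set \<Rightarrow> nat \<Rightarrow> (nat \<Rightarrow> 'a) \<Rightarrow> (nat \<Rightarrow> 'a set) \<Rightarrow> bool" where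
  "loose_cycle r V E l v e \<longleftrightarrow>
     l \<ge> 1 \<and>
     v ` {1..l * (r - 1) + 1} \<subseteq> V \<and>
     inj_on v {1..l * (r - 1)} \<and>
     v (l * (r - 1) + 1) = v 1 \<and>
     (\<forall>i\<in>{1..l}. e i = v ` {(i - 1) * (r - 1) + 1..(i - 1) * (r - 1) + r} \<and> e i \<in> E)"

text \<open>The longest loose cycle has length 0 by convention if there is no loose cycle.\<close>

definition longest_loose_cycle :: "nat \<Rightarrow> 'a set \<Rightarrow> 'a set set \<Rightarrow> nat" where
  "longest_loose_cycle r V E = Max (insert 0 {l. \<exists>v e. loose_cycle r V E l v e})"

definition F :: "nat \<Rightarrow> real \<Rightarrow> real \<Rightarrow> real" where
  "F r d x = exp (- d * (1 - x ^ (r - 1)))"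

text \<open>The condition \<open>1 - \<rho> \<ge> 0\<close> reflects that \<open>F\<close> is only considered on the nonnegative reals.\<close>

definition rho_star :: "nat \<Rightarrow> real \<Rightarrow> real" where
  "rho_star r d = (GREATEST \<rho>. 1 - \<rho> \<ge> 0 \<and> 1 - \<rho> = F r d (1 - \<rho>))"

definition rho_hat_star :: "nat \<Rightarrow> real \<Rightarrow> real" where
  "rho_hat_star r d = 1 - (1 - rho_star r d) ^ (r - 1)"

definition beta :: "nat \<Rightarrow> real \<Rightarrow> real" where
  "beta r d = d / real r *
     (1 - (1 - rho_star r d) ^ r - real r * rho_star r d * (1 - rho_star r d) ^ (r - 1))"

definition gamma :: "nat \<Rightarrow> real \<Rightarrow> real" where
  "gamma r d =
     1 - exp (- d * rho_hat_star r d) - d * rho_hat_star r d * exp (- d * rho_hat_star r d)"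

text \<open>The maxima used above exist.\<close>

lemma finite_loose_cycle_lengths:
  assumes "finite V" "r \<ge> 2"
  shows "finite {l. \<exists>v e. loose_cycle r V E l v e}"
proof (rule finite_subset)
  show "{l. \<exists>v e. loose_cycle r V E l v e} \<subseteq> {..card V}"
  proof safe
    fix l v e assume *: "loose_cycle r V E l v e"
    have "l * 1 \<le> l * (r - 1)"
      using assms by (intro mult_le_mono) auto
    also have "\<dots> = card {1..l * (r - 1)}" by simp
    also have "\<dots> \<le> card V"
      using * assms(1) unfolding loose_cycle_def
      by (intro card_inj_on_le[of v]) auto
    finally show "l \<le> card V" by simp
  qed
qed simp

lemma rho_star_greatest:
  shows "1 - rho_star r d = F r d (1 - rho_star r d)"
    and "\<And>\<rho>. 1 - \<rho> \<ge> 0 \<Longrightarrow> 1 - \<rho> = F r d (1 - \<rho>) \<Longrightarrow> \<rho> \<le> rho_star r d"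
proof -
  define S where "S = {\<rho>::real. 1 - \<rho> \<ge> 0 \<and> 1 - \<rho> = F r d (1 - \<rho>)}"
  have "closed S"
    unfolding S_def F_def by (intro closed_Collect_conj closed_Collect_le closed_Collect_eq continuous_intros)
  moreover have "0 \<in> S" by (simp add: S_def F_def)
  moreover have "bdd_above S" unfolding S_def by (intro bdd_aboveI[of _ 1]) auto
  ultimately have "Sup S \<in> S" "\<And>x. x \<in> S \<Longrightarrow> x \<le> Sup S"
    by (auto intro: closed_contains_Sup cSup_upper)
  moreover from this have "rho_star r d = Sup S"
    unfolding rho_star_def by (intro Greatest_equality) (auto simp: S_def)
  ultimately show "1 - rho_star r d = F r d (1 - rho_star r d)"
    and "\<And>\<rho>. 1 - \<rho> \<ge> 0 \<Longrightarrow> 1 - \<rho> = F r d (1 - \<rho>) \<Longrightarrow> \<rho> \<le> rho_star r d"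
    by (auto simp: S_def)
qed

end

theory Submission
  imports Defs
begin

text \<open>
  Every joint vertex of a loose cycle of length at least \<open>2 * t + 2\<close> starts two edge-disjoint
  paths of length \<open>t + 1\<close> with distinct first edges, and every edge of the cycle contains two
  vertices that start edge-disjoint paths of length \<open>t\<close> avoiding it. So it suffices to count, for
  fixed \<open>t\<close>, the vertices and the edges with this local property. A van den Berg--Kesten type
  inequality bounds the probability of these properties, at every finite \<open>n\<close>, by the corresponding
  probability in a branching tree with independent edges; no coupling is needed. As \<open>n\<close> grows and
  then \<open>t\<close> grows, the path probability tends to \<open>rho_star\<close>, and the two counts, divided by
  \<open>n\<close>, to \<open>gamma\<close> and \<open>beta\<close>. The same inequality bounds the covariances of disjointly
  occurring local events, while overlapping ones force a short chain of edges, of which there are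
  only \<open>O(n)\<close> in expectation; Chebyshev's inequality then gives concentration.
\<close>

section \<open>Expectations over random subsets\<close>

text \<open>The possible edges at a vertex overlap heavily, so exploring paths from it does not
  yield a tree with independent branches. Only upper bounds are wanted, however, and distinctness of
  edges is exactly disjoint occurrence of increasing events, so every dependence can be replaced by
  independence in the safe direction. The resulting recursion belongs to a tree in which a vertex
  has \<open>(n - 1) choose (r - 1)\<close> possible edges; in the limit their number present is
  Poisson with mean \<open>d\<close>. There \<open>rho_star\<close> is the probability that paths of
  every length start at a vertex, \<open>gamma\<close> that two edges at a vertex lead to such
  paths, and \<open>beta\<close> is the number \<open>d / r\<close> of edges per vertex times the
  probability that two of the \<open>r\<close> vertices of an edge start such paths.

  The depth \<open>t\<close> has to be fixed before \<open>n\<close> grows, since the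
  \<open>O(n)\<close> bound for overlapping events has a constant depending on \<open>t\<close>. So
  each error \<epsilon> is treated separately, and a null sequence of errors is extracted from these
  results. Cycles too short for the local property at depth \<open>t\<close> are harmless because
  \<open>beta\<close> and \<open>gamma\<close> are nonnegative and \<epsilon>\<open>n\<close>
  exceeds \<open>2 * t + 2\<close> eventually.\<close>

definition bexp :: "'a set \<Rightarrow> real \<Rightarrow> ('a set \<Rightarrow> real) \<Rightarrow> real" where
  "bexp X p f = (\<Sum>\<omega>\<in>Pow X. p ^ card \<omega> * (1 - p) ^ card (X - \<omega>) * f \<omega>)"

lemma bexp_empty [simp]: "bexp {} p f = f {}"
  by (simp add: bexp_def)

lemma bexp_cong:
  assumes "\<And>\<omega>. \<omega> \<subseteq> X \<Longrightarrow> f \<omega> = g \<omega>"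
  shows "bexp X p f = bexp X p g"
  unfolding bexp_def using assms by (intro sum.cong) auto

lemma bexp_add: "bexp X p (\<lambda>\<omega>. f \<omega> + g \<omega>) = bexp X p f + bexp X p g"
  by (simp add: bexp_def ring_distribs sum.distrib)

lemma bexp_diff: "bexp X p (\<lambda>\<omega>. f \<omega> - g \<omega>) = bexp X p f - bexp X p g"
  by (simp add: bexp_def right_diff_distrib sum_subtractf)

lemma bexp_cmult: "bexp X p (\<lambda>\<omega>. c * f \<omega>) = c * bexp X p f"
  unfolding bexp_def sum_distrib_left by (simp add: mult_ac)

lemma bexp_multc: "bexp X p (\<lambda>\<omega>. f \<omega> * c) = bexp X p f * c"
  unfolding bexp_def sum_distrib_right by (simp add: mult_ac)

lemma bexp_sum: "bexp X p (\<lambda>\<omega>. \<Sum>i\<in>I. f i \<omega>) = (\<Sum>i\<in>I. bexp X p (f i))"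
  unfolding bexp_def sum_distrib_left by (rule sum.swap)

lemma bexp_mono:
  assumes "0 \<le> p" "p \<le> 1" "\<And>\<omega>. \<omega> \<subseteq> X \<Longrightarrow> f \<omega> \<le> g \<omega>"
  shows "bexp X p f \<le> bexp X p g"
  unfolding bexp_def using assms by (intro sum_mono mult_left_mono) auto

text \<open>Conditioning on the presence of \<open>x\<close>. The later inductions over the ground
  set rest on this identity, so they are finite algebra without measure theory.\<close>

lemma bexp_insert:
  assumes "finite X" "x \<notin> X"
  shows "bexp (insert x X) p f = p * bexp X p (\<lambda>\<omega>. f (insert x \<omega>)) + (1 - p) * bexp X p f"
proof -
  let ?w = "\<lambda>Y \<omega>. p ^ card \<omega> * (1 - p) ^ card (Y - \<omega>) :: real"
  have disj: "Pow X \<inter> insert x ` Pow X = {}" and inj: "inj_on (insert x) (Pow X)"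
    using assms(2) by (auto simp: inj_on_def)
  have "bexp (insert x X) p f =
      (\<Sum>\<omega>\<in>Pow X. ?w (insert x X) \<omega> * f \<omega>) + (\<Sum>\<omega>\<in>Pow X. ?w (insert x X) (insert x \<omega>) * f (insert x \<omega>))"
    unfolding bexp_def Pow_insert
    using assms disj inj by (subst sum.union_disjoint) (auto simp: sum.reindex)
  also have "(\<Sum>\<omega>\<in>Pow X. ?w (insert x X) \<omega> * f \<omega>) = (1 - p) * bexp X p f"
    unfolding bexp_def sum_distrib_left
  proof (intro sum.cong refl)
    fix \<omega> assume "\<omega> \<in> Pow X"
    then have "insert x X - \<omega> = insert x (X - \<omega>)" "x \<notin> X - \<omega>" "finite (X - \<omega>)"
      using assms by auto
    then show "?w (insert x X) \<omega> * f \<omega> = (1 - p) * (?w X \<omega> * f \<omega>)" by simp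
  qed
  also have "(\<Sum>\<omega>\<in>Pow X. ?w (insert x X) (insert x \<omega>) * f (insert x \<omega>)) = p * bexp X p (\<lambda>\<omega>. f (insert x \<omega>))"
    unfolding bexp_def sum_distrib_left
  proof (intro sum.cong refl)
    fix \<omega> assume "\<omega> \<in> Pow X"
    then have "insert x X - insert x \<omega> = X - \<omega>" "x \<notin> \<omega>" "finite \<omega>"
      using assms finite_subset by auto
    then show "?w (insert x X) (insert x \<omega>) * f (insert x \<omega>) = p * (?w X \<omega> * f (insert x \<omega>))"
      by simp
  qed
  finally show ?thesis by simp
qed

lemma bexp_const [simp]:
  assumes "finite X"
  shows "bexp X p (\<lambda>_. c) = c"
  using assms by (induction X rule: finite_induct) (simp_all add: bexp_insert algebra_simps)

lemma bexp_subset: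
  assumes "finite X" "S \<subseteq> X"
  shows "bexp X p (\<lambda>\<omega>. of_bool (S \<subseteq> \<omega>)) = p ^ card S"
  using assms
proof (induction X arbitrary: S rule: finite_induct)
  case (insert x X)
  have fin: "finite S" using insert by (meson finite.insertI finite_subset)
  have "bexp X p (\<lambda>\<omega>. of_bool (S \<subseteq> insert x \<omega>)) = p ^ card (S - {x})"
  proof -
    have "S - {x} \<subseteq> X" using insert.prems by blast
    moreover have "S \<subseteq> insert x \<omega> \<longleftrightarrow> S - {x} \<subseteq> \<omega>" for \<omega> by blast
    ultimately show ?thesis using insert.IH by simp
  qed
  moreover have "bexp X p (\<lambda>\<omega>. of_bool (S \<subseteq> \<omega>)) = (if x \<in> S then 0 else p ^ card S)"
  proof (cases "x \<in> S")
    case True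
    then have "bexp X p (\<lambda>\<omega>. of_bool (S \<subseteq> \<omega>)) = bexp X p (\<lambda>\<omega>. 0)"
      using insert.hyps by (intro bexp_cong) auto
    with True insert.hyps show ?thesis by simp
  qed (use insert in auto)
  moreover have "p ^ card S = p * p ^ card (S - {x})" if "x \<in> S"
    unfolding card.remove[OF fin that] by (rule power_Suc)
  ultimately show ?case
    using insert.hyps by (cases "x \<in> S") (simp_all add: bexp_insert algebra_simps del: card_Diff_insert)
qed simp

text \<open>The bridge from the pmf of the statement to finite sums. A product measure on
  \<open>insert x X\<close> is a Bernoulli draw followed by the product on \<open>X\<close>, which
  matches \<open>bexp_insert\<close>; for \<open>p\<close> in the unit interval
  \<open>bernoulli_pmf\<close> does not truncate.\<close>

lemma prob_Pi_pmf_eq_bexp: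
  assumes "finite X" "0 \<le> p" "p \<le> 1"
  shows "measure_pmf.prob (map_pmf (\<lambda>f. {x \<in> X. f x}) (Pi_pmf X False (\<lambda>_. bernoulli_pmf p))) A
    = bexp X p (\<lambda>\<omega>. of_bool (\<omega> \<in> A))"
  using assms(1)
proof (induction X arbitrary: A rule: finite_induct)
  case (insert x X)
  let ?M = "map_pmf (\<lambda>f. {x \<in> X. f x}) (Pi_pmf X False (\<lambda>_. bernoulli_pmf p))"
  have "map_pmf (\<lambda>f. {y \<in> insert x X. f y}) (Pi_pmf (insert x X) False (\<lambda>_. bernoulli_pmf p))
     = bind_pmf (bernoulli_pmf p) (\<lambda>b. map_pmf (\<lambda>\<omega>. if b then insert x \<omega> else \<omega>) ?M)"
    using insert.hyps
    by (auto simp: Pi_pmf_insert' map_bind_pmf bind_map_pmf map_pmf_comp simp flip: map_pmf_def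
        intro!: bind_pmf_cong map_pmf_cong split: if_splits)
  moreover have "measure_pmf.prob (bind_pmf M N) B = measure_pmf.expectation M (\<lambda>x. measure_pmf.prob (N x) B)"
    for M :: "bool pmf" and N :: "bool \<Rightarrow> 'a set pmf" and B
    unfolding measure_pmf_bind
    by (rule measure_pmf.measure_bind[of _ _ "count_space UNIV"])
      (auto simp: space_subprob_algebra intro!: prob_space_imp_subprob_space prob_space_measure_pmf)
  ultimately have "measure_pmf.prob (map_pmf (\<lambda>f. {y \<in> insert x X. f y}) (Pi_pmf (insert x X) False (\<lambda>_. bernoulli_pmf p))) A
     = p * measure_pmf.prob ?M (insert x -` A) + (1 - p) * measure_pmf.prob ?M A"
    using assms by (simp add: integral_bernoulli_pmf vimage_def)
  then show ?case
    unfolding insert.IH bexp_insert[OF insert.hyps(1,2)] by (simp add: vimage_def)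
qed (simp add: indicator_def)

section \<open>Disjoint occurrence\<close>

text \<open>
  A van den Berg--Kesten type inequality, proved by giving the coordinates independent second
  copies one at a time: conditionally on the other coordinates, the only case that matters is the
  one where a pair succeeds if and only if the coordinate is present, and then this pair uses only
  one of its two copies.
\<close>

lemma bexp_disjoint_pairs_le:
  assumes "finite X" "0 \<le> p" "p \<le> 1" "\<And>S T. G S T \<Longrightarrow> S \<inter> T = {}"
  shows "bexp X p (\<lambda>\<omega>. of_bool (\<exists>S T. G S T \<and> S \<subseteq> \<omega> \<and> T \<subseteq> \<omega>))
       \<le> bexp X p (\<lambda>\<omega>. bexp X p (\<lambda>\<omega>'. of_bool (\<exists>S T. G S T \<and> S \<subseteq> \<omega> \<and> T \<subseteq> \<omega>')))"
  using assms(1,4)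
proof (induction X arbitrary: G rule: finite_induct)
  case (insert x X)
  let ?E = "bexp X p"
  let ?o = "\<lambda>A B. (of_bool (\<exists>S T. G S T \<and> S \<subseteq> A \<and> T \<subseteq> B) :: real)"
  \<comment> \<open>Once \<open>x\<close> is present in both copies it no longer constrains a pair.
    Deleting it from all witnesses gives a family of disjoint pairs to which the induction
    hypothesis applies.\<close>
  define G' where "G' S T \<longleftrightarrow> (\<exists>S' T'. G S' T' \<and> S = S' - {x} \<and> T = T' - {x})" for S T
  have G': "(\<exists>S T. G' S T \<and> S \<subseteq> A \<and> T \<subseteq> B) \<longleftrightarrow>
      (\<exists>S T. G S T \<and> S \<subseteq> insert x A \<and> T \<subseteq> insert x B)" for A B
  proof
    assume "\<exists>S T. G' S T \<and> S \<subseteq> A \<and> T \<subseteq> B"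
    then obtain S T where "G S T" "S - {x} \<subseteq> A" "T - {x} \<subseteq> B"
      unfolding G'_def by blast
    then show "\<exists>S T. G S T \<and> S \<subseteq> insert x A \<and> T \<subseteq> insert x B" by blast
  next
    assume "\<exists>S T. G S T \<and> S \<subseteq> insert x A \<and> T \<subseteq> insert x B"
    then obtain S T where "G S T" "S - {x} \<subseteq> A" "T - {x} \<subseteq> B" by blast
    then show "\<exists>S T. G' S T \<and> S \<subseteq> A \<and> T \<subseteq> B"
      unfolding G'_def by blast
  qed
  have IH1: "?E (\<lambda>\<omega>. ?o (insert x \<omega>) (insert x \<omega>)) \<le>
      ?E (\<lambda>\<omega>. ?E (\<lambda>\<omega>'. ?o (insert x \<omega>) (insert x \<omega>')))"
    using insert.IH[of G'] insert.prems unfolding G' by (force simp: G'_def)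
  have IH2: "?E (\<lambda>\<omega>. ?o \<omega> \<omega>) \<le> ?E (\<lambda>\<omega>. ?E (\<lambda>\<omega>'. ?o \<omega> \<omega>'))"
    using insert by blast
  \<comment> \<open>One shared copy of the coordinate \<open>x\<close> on the left, two independent
    copies on the right. The difference of the two sides is \<open>p * (1 - p)\<close> times a
    combination of the four values of \<open>?o\<close>, so it suffices that the two equal settings
    together are at most the two mixed ones.\<close>
  have pt: "p * ?o (insert x \<omega>) (insert x \<omega>') + (1 - p) * ?o \<omega> \<omega>' \<le>
      p * (p * ?o (insert x \<omega>) (insert x \<omega>') + (1 - p) * ?o (insert x \<omega>) \<omega>')
      + (1 - p) * (p * ?o \<omega> (insert x \<omega>') + (1 - p) * ?o \<omega> \<omega>')" for \<omega> \<omega>'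
  proof -
    have "?o (insert x \<omega>) (insert x \<omega>') \<le> max (?o (insert x \<omega>) \<omega>') (?o \<omega> (insert x \<omega>'))"
    proof (cases "\<exists>S T. G S T \<and> S \<subseteq> insert x \<omega> \<and> T \<subseteq> insert x \<omega>'")
      case True
      then obtain S T where ST: "G S T" "S \<subseteq> insert x \<omega>" "T \<subseteq> insert x \<omega>'" by blast
      then have "x \<notin> S \<or> x \<notin> T" using insert.prems by blast
      with ST have "S \<subseteq> \<omega> \<or> T \<subseteq> \<omega>'" by blast
      with ST have "?o (insert x \<omega>) \<omega>' = 1 \<or> ?o \<omega> (insert x \<omega>') = 1"
        by (auto simp only: of_bool_eq_1_iff)
      then show ?thesis by (auto simp: max_def)
    qed auto
    moreover have "?o \<omega> \<omega>' \<le> min (?o (insert x \<omega>) \<omega>') (?o \<omega> (insert x \<omega>'))"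
    proof (cases "\<exists>S T. G S T \<and> S \<subseteq> \<omega> \<and> T \<subseteq> \<omega>'")
      case True
      then have "?o (insert x \<omega>) \<omega>' = 1" "?o \<omega> (insert x \<omega>') = 1"
        unfolding of_bool_eq_1_iff by blast+
      then show ?thesis by simp
    qed auto
    ultimately have "?o (insert x \<omega>) (insert x \<omega>') + ?o \<omega> \<omega>' \<le>
        ?o (insert x \<omega>) \<omega>' + ?o \<omega> (insert x \<omega>')"
      by linarith
    then have "(p * (1 - p)) * (?o (insert x \<omega>) (insert x \<omega>') + ?o \<omega> \<omega>') \<le>
        (p * (1 - p)) * (?o (insert x \<omega>) \<omega>' + ?o \<omega> (insert x \<omega>'))"
      using assms by (intro mult_left_mono) auto
    then show ?thesis by (simp add: algebra_simps)
  qed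
  have "bexp (insert x X) p (\<lambda>\<omega>. ?o \<omega> \<omega>) =
      p * ?E (\<lambda>\<omega>. ?o (insert x \<omega>) (insert x \<omega>)) + (1 - p) * ?E (\<lambda>\<omega>. ?o \<omega> \<omega>)"
    using insert.hyps by (simp add: bexp_insert)
  also have "\<dots> \<le> p * ?E (\<lambda>\<omega>. ?E (\<lambda>\<omega>'. ?o (insert x \<omega>) (insert x \<omega>')))
      + (1 - p) * ?E (\<lambda>\<omega>. ?E (\<lambda>\<omega>'. ?o \<omega> \<omega>'))"
    using IH1 IH2 assms by (intro add_mono mult_left_mono) auto
  also have "\<dots> = ?E (\<lambda>\<omega>. ?E (\<lambda>\<omega>'. p * ?o (insert x \<omega>) (insert x \<omega>') + (1 - p) * ?o \<omega> \<omega>'))"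
    by (simp only: bexp_add bexp_cmult)
  also have "\<dots> \<le> ?E (\<lambda>\<omega>. ?E (\<lambda>\<omega>'.
      p * (p * ?o (insert x \<omega>) (insert x \<omega>') + (1 - p) * ?o (insert x \<omega>) \<omega>')
      + (1 - p) * (p * ?o \<omega> (insert x \<omega>') + (1 - p) * ?o \<omega> \<omega>')))"
    using assms(2,3) by (intro bexp_mono pt)
  also have "\<dots> = bexp (insert x X) p (\<lambda>\<omega>. bexp (insert x X) p (\<lambda>\<omega>'. ?o \<omega> \<omega>'))"
    unfolding bexp_insert[OF insert.hyps(1,2)] bexp_add bexp_cmult by (simp add: algebra_simps)
  finally show ?case .
qed simp

text \<open>Increasing events are encoded by families of witness sets, since disjoint occurrence
  depends on which elements are used to verify an event.\<close>

definition occurs :: "'a set set \<Rightarrow> 'a set \<Rightarrow> bool" where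
  "occurs W \<omega> \<longleftrightarrow> (\<exists>S\<in>W. S \<subseteq> \<omega>)"

definition disj_prod :: "'a set set \<Rightarrow> 'a set set \<Rightarrow> 'a set set" (infixl "\<odot>" 70) where
  "A \<odot> B = {S \<union> T | S T. S \<in> A \<and> T \<in> B \<and> S \<inter> T = {}}"

definition disj_pairs :: "'i set \<Rightarrow> ('i \<Rightarrow> 'a set set) \<Rightarrow> 'a set set" where
  "disj_pairs I W = (\<Union>i\<in>I. \<Union>j\<in>I - {i}. W i \<odot> W j)"

lemma disj_prod_commute: "A \<odot> B = B \<odot> A"
  unfolding disj_prod_def by (auto simp: Un_commute Int_commute)

lemma disj_prod_UN_left: "(\<Union>i\<in>I. A i) \<odot> B = (\<Union>i\<in>I. A i \<odot> B)"
  unfolding disj_prod_def by blast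

lemma disj_pairs_insert:
  assumes "k \<notin> I"
  shows "disj_pairs (insert k I) W = disj_pairs I W \<union> ((\<Union>i\<in>I. W i) \<odot> W k)"
  using assms unfolding disj_pairs_def disj_prod_UN_left
  by (auto simp: disj_prod_commute[of "W k"])

text \<open>The probability that a binomial variable with \<open>m\<close> trials of success
  probability \<open>b\<close> is at least 2.\<close>

definition at_least_two :: "nat \<Rightarrow> real \<Rightarrow> real" where
  "at_least_two m b = 1 - (1 - b) ^ m - real m * b * (1 - b) ^ (m - 1)"

text \<open>Condition on the extra trial: after a failure two successes are still required, after a
  success only one.\<close>

lemma at_least_two_Suc: "at_least_two (Suc m) b = (1 - b) * at_least_two m b + b * (1 - (1 - b) ^ m)"
  unfolding at_least_two_def by (cases m) (simp_all add: algebra_simps)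

lemma at_least_two_nonneg:
  assumes "0 \<le> b" "b \<le> 1"
  shows "0 \<le> at_least_two m b"
proof (induction m)
  case (Suc m)
  then show ?case
    using assms unfolding at_least_two_Suc by (intro add_nonneg_nonneg mult_nonneg_nonneg) (auto intro: power_le_one)
qed (simp add: at_least_two_def)

section \<open>Independent upper bounds for unions and disjoint pairs of increasing events\<close>

locale random_subset =
  fixes X :: "'a set" and p :: real
  assumes finite_X: "finite X" and p_nonneg: "0 \<le> p" and p_le_1: "p \<le> 1"
begin

definition pr :: "'a set set \<Rightarrow> real" where
  "pr W = bexp X p (\<lambda>\<omega>. of_bool (occurs W \<omega>))"

lemmas mono = bexp_mono[OF p_nonneg p_le_1]

lemma pr_mono: "(\<And>\<omega>. \<omega> \<subseteq> X \<Longrightarrow> occurs A \<omega> \<Longrightarrow> occurs B \<omega>) \<Longrightarrow> pr A \<le> pr B"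
  unfolding pr_def by (intro mono) auto

lemma pr_le_1: "pr W \<le> 1"
  using mono[of X _ "\<lambda>_. 1"] finite_X by (simp add: pr_def)

lemma pr_empty [simp]: "pr {} = 0"
  using finite_X by (simp add: pr_def occurs_def)

lemma pr_trivial [simp]: "pr {{}} = 1"
  using finite_X by (simp add: pr_def occurs_def)

lemma pr_singleton: "S \<subseteq> X \<Longrightarrow> pr {S} = p ^ card S"
  using finite_X by (simp add: pr_def occurs_def bexp_subset)

text \<open>With \<open>C\<close> moved to an independent copy, the event is that \<open>A\<close>
  occurs, or that \<open>B\<close> occurs without \<open>A\<close> while \<open>C\<close> occurs in
  the copy. This one form covers products (\<open>A = {}\<close>), unions (\<open>B = {{}}\<close>)
  and the step that adds an index to \<open>disj_pairs\<close>.\<close>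

lemma pr_Un_disj_prod_le:
  assumes "\<And>\<omega>. occurs A \<omega> \<Longrightarrow> occurs B \<omega>"
  shows "pr (A \<union> (B \<odot> C)) \<le> pr A + pr C * (pr B - pr A)"
proof -
  \<comment> \<open>A witness of \<open>A\<close> is paired with the empty set, so it makes no
    demand on the second copy.\<close>
  define G where "G S T \<longleftrightarrow> (S \<in> A \<and> T = {}) \<or> (S \<in> B \<and> T \<in> C \<and> S \<inter> T = {})" for S T
  have "pr (A \<union> (B \<odot> C)) = bexp X p (\<lambda>\<omega>. of_bool (\<exists>S T. G S T \<and> S \<subseteq> \<omega> \<and> T \<subseteq> \<omega>))"
    unfolding pr_def occurs_def disj_prod_def G_def
  proof (intro bexp_cong arg_cong[where f = of_bool])
    fix \<omega>
    show "(\<exists>S\<in>A \<union> {S \<union> T |S T. S \<in> B \<and> T \<in> C \<and> S \<inter> T = {}}. S \<subseteq> \<omega>) \<longleftrightarrow>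
      (\<exists>S T. (S \<in> A \<and> T = {} \<or> S \<in> B \<and> T \<in> C \<and> S \<inter> T = {}) \<and> S \<subseteq> \<omega> \<and> T \<subseteq> \<omega>)"
      (is "?l \<longleftrightarrow> ?r")
    proof
      assume ?l
      then obtain S where S: "S \<in> A \<or> (\<exists>T U. S = T \<union> U \<and> T \<in> B \<and> U \<in> C \<and> T \<inter> U = {})" "S \<subseteq> \<omega>"
        by auto
      then show ?r by (metis Un_subset_iff empty_subsetI)
    next
      assume ?r
      then obtain S T where "S \<in> A \<and> T = {} \<or> S \<in> B \<and> T \<in> C \<and> S \<inter> T = {}" "S \<union> T \<subseteq> \<omega>"
        by auto
      then show ?l by (intro bexI[of _ "S \<union> T"]) auto
    qed
  qed
  also have "\<dots> \<le> bexp X p (\<lambda>\<omega>. bexp X p (\<lambda>\<omega>'. of_bool (\<exists>S T. G S T \<and> S \<subseteq> \<omega> \<and> T \<subseteq> \<omega>')))"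
    by (rule bexp_disjoint_pairs_le[OF finite_X p_nonneg p_le_1]) (auto simp: G_def)
  also have "\<dots> \<le> bexp X p (\<lambda>\<omega>. bexp X p (\<lambda>\<omega>'. of_bool (occurs A \<omega>)
      + of_bool (occurs C \<omega>') * (of_bool (occurs B \<omega>) - of_bool (occurs A \<omega>))))"
  proof (intro mono)
    fix \<omega> \<omega>'
    show "(of_bool (\<exists>S T. G S T \<and> S \<subseteq> \<omega> \<and> T \<subseteq> \<omega>') :: real) \<le> of_bool (occurs A \<omega>)
      + of_bool (occurs C \<omega>') * (of_bool (occurs B \<omega>) - of_bool (occurs A \<omega>))"
      using assms[of \<omega>] by (auto simp: G_def occurs_def)
  qed
  also have "\<dots> = pr A + pr C * (pr B - pr A)"
    using finite_X by (simp add: bexp_add bexp_multc bexp_cmult bexp_diff flip: pr_def)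
  finally show ?thesis .
qed

lemma pr_disj_prod_le: "pr (A \<odot> B) \<le> pr A * pr B"
  using pr_Un_disj_prod_le[of "{}" A B] by (simp add: occurs_def mult.commute)

lemma pr_UN_le:
  assumes "finite I" "\<And>i. i \<in> I \<Longrightarrow> pr (W i) \<le> b" "b \<le> 1"
  shows "pr (\<Union>i\<in>I. W i) \<le> 1 - (1 - b) ^ card I"
  using assms(1,2)
proof (induction I rule: finite_induct)
  case (insert k I)
  let ?P = "pr (\<Union>i\<in>I. W i)"
  \<comment> \<open>\<open>{{}}\<close> is the sure event, and a disjoint product with it changes
    nothing; this writes the union in the form required by
    \<open>pr_Un_disj_prod_le\<close>.\<close>
  have "pr (\<Union>i\<in>insert k I. W i) = pr ((\<Union>i\<in>I. W i) \<union> ({{}} \<odot> W k))"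
    by (simp add: disj_prod_def Un_commute)
  also have "\<dots> \<le> ?P + pr (W k) * (1 - ?P)"
    using pr_Un_disj_prod_le[of "\<Union>i\<in>I. W i" "{{}}" "W k"] by (simp add: occurs_def)
  also have "\<dots> \<le> ?P + b * (1 - ?P)"
    using insert.prems pr_le_1 by (intro add_left_mono mult_right_mono) auto
  also have "\<dots> = 1 - (1 - b) * (1 - ?P)"
    by (simp add: algebra_simps)
  also have "\<dots> \<le> 1 - (1 - b) * (1 - b) ^ card I"
    using insert assms(3) by (intro diff_left_mono mult_left_mono) auto
  finally show ?case using insert.hyps by simp
qed simp

text \<open>A new index \<open>k\<close> contributes only pairs formed by \<open>W k\<close> and an
  earlier event, so the bound obeys the recursion \<open>at_least_two_Suc\<close>. Replacing
  \<open>pr (W k)\<close> by \<open>b\<close> uses \<open>?Q \<le> ?P\<close>; after regrouping,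
  both coefficients are nonnegative and the induction hypothesis can be inserted.\<close>

lemma pr_disj_pairs_le:
  assumes "finite I" "\<And>i. i \<in> I \<Longrightarrow> pr (W i) \<le> b" "b \<le> 1" "0 \<le> b"
  shows "pr (disj_pairs I W) \<le> at_least_two (card I) b"
  using assms(1,2)
proof (induction I rule: finite_induct)
  case empty
  then show ?case by (simp add: disj_pairs_def at_least_two_def)
next
  case (insert k I)
  let ?P = "pr (\<Union>i\<in>I. W i)" and ?Q = "pr (disj_pairs I W)"
  have sub: "occurs (\<Union>i\<in>I. W i) \<omega>" if "occurs (disj_pairs I W) \<omega>" for \<omega>
    using that unfolding occurs_def disj_pairs_def disj_prod_def by blast
  have "pr (disj_pairs (insert k I) W) \<le> ?Q + pr (W k) * (?P - ?Q)"
    unfolding disj_pairs_insert[OF insert.hyps(2)] by (rule pr_Un_disj_prod_le[OF sub])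
  also have "\<dots> \<le> ?Q + b * (?P - ?Q)"
    using insert.prems pr_mono[OF sub] by (intro add_left_mono mult_right_mono) auto
  also have "\<dots> = (1 - b) * ?Q + b * ?P"
    by (simp add: algebra_simps)
  also have "\<dots> \<le> (1 - b) * at_least_two (card I) b + b * (1 - (1 - b) ^ card I)"
    using insert assms(3,4) by (intro add_mono mult_left_mono pr_UN_le) auto
  also have "\<dots> = at_least_two (Suc (card I)) b"
    by (simp only: at_least_two_Suc)
  finally show ?case using insert.hyps by simp
qed

end

section \<open>A second moment bound\<close>

text \<open>The part of a joint occurrence that \<odot> misses: the chosen witnesses share an
  element.\<close>

definition overlaps :: "'a set set \<Rightarrow> 'a set set \<Rightarrow> 'a set set" where
  "overlaps A B = {S \<union> T | S T. S \<in> A \<and> T \<in> B \<and> S \<inter> T \<noteq> {}}"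

text \<open>If two events both occur, then either they occur disjointly, which is at most as likely
  as under independence, or two of their witnesses overlap. Hence the variance is at most the sum
  over overlaps. An upper bound \<open>m\<close> for the mean is enough because only the upper tail
  is estimated.\<close>

lemma (in random_subset) second_moment_tail:
  fixes W :: "'i \<Rightarrow> 'a set set"
  assumes "finite I" "(\<Sum>i\<in>I. pr (W i)) \<le> m" "a > 0"
  shows "bexp X p (\<lambda>\<omega>. of_bool (m + a < (\<Sum>i\<in>I. of_bool (occurs (W i) \<omega>))))
    \<le> (\<Sum>i\<in>I. \<Sum>j\<in>I. pr (overlaps (W i) (W j))) / a\<^sup>2"
proof -
  define N :: "'a set \<Rightarrow> real" where "N \<omega> = (\<Sum>i\<in>I. of_bool (occurs (W i) \<omega>))" for \<omega>
  define \<mu> where "\<mu> = (\<Sum>i\<in>I. pr (W i))"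
  define R where "R = (\<Sum>i\<in>I. \<Sum>j\<in>I. pr (overlaps (W i) (W j)))"
  have mean: "bexp X p N = \<mu>"
    unfolding N_def \<mu>_def bexp_sum pr_def ..
  have pair: "bexp X p (\<lambda>\<omega>. of_bool (occurs (W i) \<omega>) * of_bool (occurs (W j) \<omega>))
      \<le> pr (W i) * pr (W j) + pr (overlaps (W i) (W j))" for i j
  proof -
    have "bexp X p (\<lambda>\<omega>. of_bool (occurs (W i) \<omega>) * of_bool (occurs (W j) \<omega>))
      \<le> bexp X p (\<lambda>\<omega>. of_bool (occurs (W i \<odot> W j) \<omega>) + of_bool (occurs (overlaps (W i) (W j)) \<omega>))"
    proof (intro mono)
      fix \<omega>
      have "occurs (W i \<odot> W j) \<omega> \<or> occurs (overlaps (W i) (W j)) \<omega>"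
        if "occurs (W i) \<omega>" "occurs (W j) \<omega>"
      proof -
        obtain S T where ST: "S \<in> W i" "T \<in> W j" "S \<union> T \<subseteq> \<omega>"
          using \<open>occurs (W i) \<omega>\<close> \<open>occurs (W j) \<omega>\<close> unfolding occurs_def by (meson Un_least)
        have "S \<union> T \<in> W i \<odot> W j \<or> S \<union> T \<in> overlaps (W i) (W j)"
        proof (cases "S \<inter> T = {}")
          case True
          with ST(1,2) show ?thesis
            unfolding disj_prod_def mem_Collect_eq by (intro disjI1 exI[of _ S] exI[of _ T]) simp
        next
          case False
          with ST(1,2) show ?thesis
            unfolding overlaps_def mem_Collect_eq by (intro disjI2 exI[of _ S] exI[of _ T]) simp
        qed
        with ST show ?thesis unfolding occurs_def by blast
      qed
      then show "(of_bool (occurs (W i) \<omega>) * of_bool (occurs (W j) \<omega>) :: real)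
        \<le> of_bool (occurs (W i \<odot> W j) \<omega>) + of_bool (occurs (overlaps (W i) (W j)) \<omega>)"
        by auto
    qed
    also have "\<dots> = pr (W i \<odot> W j) + pr (overlaps (W i) (W j))"
      by (simp add: bexp_add pr_def)
    finally show ?thesis using pr_disj_prod_le[of "W i" "W j"] by linarith
  qed
  have "bexp X p (\<lambda>\<omega>. (N \<omega>)\<^sup>2) =
      (\<Sum>i\<in>I. \<Sum>j\<in>I. bexp X p (\<lambda>\<omega>. of_bool (occurs (W i) \<omega>) * of_bool (occurs (W j) \<omega>)))"
    unfolding N_def power2_eq_square sum_product bexp_sum ..
  also have "\<dots> \<le> (\<Sum>i\<in>I. \<Sum>j\<in>I. pr (W i) * pr (W j) + pr (overlaps (W i) (W j)))"
    by (intro sum_mono pair)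
  also have "\<dots> = \<mu>\<^sup>2 + R"
    unfolding \<mu>_def R_def power2_eq_square sum_product by (simp add: sum.distrib)
  finally have second: "bexp X p (\<lambda>\<omega>. (N \<omega>)\<^sup>2) \<le> \<mu>\<^sup>2 + R" .
  have "bexp X p (\<lambda>\<omega>. of_bool (m + a < N \<omega>)) \<le> bexp X p (\<lambda>\<omega>. ((N \<omega>)\<^sup>2 - 2 * \<mu> * N \<omega> + \<mu>\<^sup>2) * (1 / a\<^sup>2))"
  proof (intro mono)
    fix \<omega>
    have "a\<^sup>2 \<le> (N \<omega> - \<mu>)\<^sup>2" if "m + a < N \<omega>"
      using that assms(2,3) by (intro power_mono) (auto simp: \<mu>_def)
    then have "of_bool (m + a < N \<omega>) \<le> (N \<omega> - \<mu>)\<^sup>2 / a\<^sup>2"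
      using assms(3) by (auto simp: divide_simps)
    moreover have "(N \<omega>)\<^sup>2 - 2 * \<mu> * N \<omega> + \<mu>\<^sup>2 = (N \<omega> - \<mu>)\<^sup>2"
      by (simp add: power2_diff)
    ultimately show "of_bool (m + a < N \<omega>) \<le> ((N \<omega>)\<^sup>2 - 2 * \<mu> * N \<omega> + \<mu>\<^sup>2) * (1 / a\<^sup>2)"
      by simp
  qed
  also have "\<dots> = (bexp X p (\<lambda>\<omega>. (N \<omega>)\<^sup>2) - 2 * \<mu> * \<mu> + \<mu>\<^sup>2) * (1 / a\<^sup>2)"
    by (simp only: bexp_multc bexp_add bexp_diff bexp_cmult bexp_const[OF finite_X] mean)
  also have "\<dots> \<le> R * (1 / a\<^sup>2)"
    using second by (intro mult_right_mono) (auto simp: power2_eq_square)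
  finally show ?thesis by (simp add: N_def R_def)
qed

section \<open>Paths and chains of edges\<close>

text \<open>
  The witnesses of a path from \<open>u\<close>: consecutive edges share a vertex, and all edges are distinct.
  Distinctness of the vertices is dropped, which only enlarges the events.
\<close>

fun paths :: "'v set set \<Rightarrow> nat \<Rightarrow> 'v \<Rightarrow> 'v set set set" where
  "paths X 0 u = {{}}"
| "paths X (Suc t) u = (\<Union>e\<in>{e\<in>X. u \<in> e}. {{e}} \<odot> (\<Union>w\<in>e - {u}. paths X t w))"

text \<open>Paths of length \<open>t + 1\<close> from \<open>u\<close> with prescribed first edge
  \<open>e\<close>. They are indexed by \<open>e\<close> so that \<open>vertex_wit\<close> can ask
  for two different first edges.\<close>

definition branches :: "'v set set \<Rightarrow> nat \<Rightarrow> 'v \<Rightarrow> 'v set \<Rightarrow> 'v set set set" where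
  "branches X t u e = {{e}} \<odot> (\<Union>w\<in>e - {u}. paths X t w)"

definition vertex_wit :: "'v set set \<Rightarrow> nat \<Rightarrow> 'v \<Rightarrow> 'v set set set" where
  "vertex_wit X t u = disj_pairs {e\<in>X. u \<in> e} (branches X t u)"

definition edge_wit :: "'v set set \<Rightarrow> nat \<Rightarrow> 'v set \<Rightarrow> 'v set set set" where
  "edge_wit X t e = {{e}} \<odot> disj_pairs e (paths X t)"

text \<open>Weaker than a path: consecutive edges merely meet. Chains can therefore be reversed,
  glued and shortened, and they are easy to count.\<close>

definition chain :: "'v set set \<Rightarrow> 'v set list \<Rightarrow> bool" where
  "chain S xs \<longleftrightarrow> xs \<noteq> [] \<and> set xs \<subseteq> S \<and> successively (\<lambda>e f. e \<inter> f \<noteq> {}) xs"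

lemma chain_Cons:
  "chain S (e # xs) \<longleftrightarrow> e \<in> S \<and> (xs = [] \<or> e \<inter> hd xs \<noteq> {} \<and> chain S xs)"
  by (auto simp: chain_def successively_Cons)

lemma chain_mono: "chain S xs \<Longrightarrow> S \<subseteq> T \<Longrightarrow> chain T xs"
  by (auto simp: chain_def)

lemma chain_extend:
  assumes "chain S' xs" "S' \<subseteq> S" "e \<in> S" "w \<in> e" "w \<in> hd xs"
  shows "\<exists>ys. chain S ys \<and> length ys = Suc (length xs) \<and> hd ys = e \<and> last ys = last xs"
  using assms chain_mono[of S' xs S]
  by (intro exI[of _ "e # xs"]) (auto simp: chain_Cons, auto simp: chain_def)

text \<open>Cut out the stretch between two occurrences of the same edge. Distinctness matters
  because only then is the probability that all edges of the chain are present \<open>p\<close> to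
  the power of its length.\<close>

lemma chain_distinct:
  assumes "chain S xs"
  shows "\<exists>ys. chain S ys \<and> distinct ys \<and> length ys \<le> length xs \<and> hd ys = hd xs \<and> last ys = last xs"
  using assms
proof (induction "length xs" arbitrary: xs rule: less_induct)
  case less
  show ?case
  proof (cases "distinct xs")
    case False
    then obtain a y b c where xs: "xs = a @ [y] @ b @ [y] @ c"
      using not_distinct_decomp by blast
    let ?zs = "a @ [y] @ c"
    have "chain S ?zs" "length ?zs < length xs" "hd ?zs = hd xs" "last ?zs = last xs"
      using less.prems unfolding xs
      by (auto simp: chain_def successively_append_iff successively_Cons hd_append)
    then show ?thesis using less.hyps[of ?zs] by force
  qed (use less.prems in auto)
qed

text \<open>Follow \<open>xs\<close> to the common last edge and then \<open>ys\<close> backwards;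
  \<open>tl\<close> drops the second copy of that edge.\<close>

lemma chain_join:
  assumes "chain S xs" "chain S ys" "last xs = last ys"
  shows "\<exists>zs. chain S zs \<and> length zs \<le> length xs + length ys \<and> hd zs = hd xs \<and> last zs = hd ys"
proof -
  let ?zs = "xs @ tl (rev ys)"
  have ys: "rev ys = last xs # tl (rev ys)"
    using assms by (metis chain_def hd_Cons_tl hd_rev rev_is_Nil_conv)
  have "chain S (rev ys)"
    using assms(2) by (auto simp: chain_def Int_commute)
  then have "chain S ?zs"
    using assms(1) by (subst (asm) ys) (auto simp: chain_def successively_append_iff successively_Cons)
  moreover have "last ?zs = hd ys"
    by (metis append_Nil2 assms(1,2) chain_def last.simps last_append last_rev rev_is_Nil_conv ys)
  moreover have "length ?zs \<le> length xs + length ys" "hd ?zs = hd xs"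
    using assms(1) by (auto simp: chain_def)
  ultimately show ?thesis by blast
qed

text \<open>Stop the path when it reaches \<open>g\<close>. Connectedness of witnesses is what turns
  a shared edge of two witnesses into a chain between their indices.\<close>

lemma chain_of_paths:
  assumes "S \<in> paths X t u" "g \<in> S"
  shows "\<exists>xs. chain S xs \<and> length xs \<le> t \<and> u \<in> hd xs \<and> last xs = g"
  using assms
proof (induction t arbitrary: u S)
  case (Suc t)
  then obtain e w S' where *: "u \<in> e" "w \<in> e" "S' \<in> paths X t w" "S = insert e S'"
    by (auto simp: disj_prod_def)
  show ?case
  proof (cases "g = e")
    case True
    with * show ?thesis by (intro exI[of _ "[e]"]) (auto simp: chain_def)
  next
    case False
    with * Suc obtain xs where "chain S' xs" "length xs \<le> t" "w \<in> hd xs" "last xs = g"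
      by blast
    moreover from * have "S' \<subseteq> S" "e \<in> S" by auto
    ultimately obtain ys where "chain S ys" "length ys = Suc (length xs)" "hd ys = e" "last ys = last xs"
      using chain_extend[of S' xs S e w] * by metis
    with * \<open>length xs \<le> t\<close> \<open>last xs = g\<close> show ?thesis
      by (intro exI[of _ ys]) simp
  qed
qed simp

lemma chain_of_branches:
  assumes "S \<in> branches X t u e" "u \<in> e" "g \<in> S"
  shows "\<exists>xs. chain S xs \<and> length xs \<le> Suc t \<and> hd xs = e \<and> last xs = g"
proof -
  obtain w S' where *: "w \<in> e" "S' \<in> paths X t w" "S = insert e S'"
    using assms(1) by (auto simp: disj_prod_def branches_def)
  show ?thesis
  proof (cases "g = e")
    case True
    with * show ?thesis by (intro exI[of _ "[e]"]) (auto simp: chain_def)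
  next
    case False
    with * assms(3) obtain xs where "chain S' xs" "length xs \<le> t" "w \<in> hd xs" "last xs = g"
      using chain_of_paths[of S' X t w g] by blast
    moreover from * have "S' \<subseteq> S" "e \<in> S" by auto
    ultimately obtain ys where "chain S ys" "length ys = Suc (length xs)" "hd ys = e" "last ys = last xs"
      using chain_extend[of S' xs S e w] * by metis
    with * \<open>length xs \<le> t\<close> \<open>last xs = g\<close> show ?thesis
      by (intro exI[of _ ys]) simp
  qed
qed

lemma chain_of_vertex_wit:
  assumes "S \<in> vertex_wit X t u" "g \<in> S"
  shows "\<exists>xs. chain S xs \<and> length xs \<le> Suc t \<and> u \<in> hd xs \<and> last xs = g"
proof -
  obtain e S' where "u \<in> e" "S' \<in> branches X t u e" "S' \<subseteq> S" "g \<in> S'"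
    using assms unfolding vertex_wit_def disj_pairs_def disj_prod_def by blast
  then show ?thesis using chain_of_branches[of S' X t u e g] chain_mono by blast
qed

lemma chain_of_edge_wit:
  assumes "S \<in> edge_wit X t e" "g \<in> S"
  shows "\<exists>xs. chain S xs \<and> length xs \<le> Suc t \<and> hd xs = e \<and> last xs = g"
proof (cases "g = e")
  case True
  with assms show ?thesis by (intro exI[of _ "[e]"]) (auto simp: chain_def)
next
  case False
  obtain U where U: "S = insert e U" "U \<in> disj_pairs e (paths X t)"
    using assms(1) by (auto simp: edge_wit_def disj_prod_def)
  with False assms(2) have "g \<in> U" by auto
  with U(2) obtain w S' where "w \<in> e" "S' \<in> paths X t w" "S' \<subseteq> U" "g \<in> S'"
    unfolding disj_pairs_def disj_prod_def by blast
  with U(1) have *: "w \<in> e" "S' \<in> paths X t w" "S' \<subseteq> S" "e \<in> S" "g \<in> S'" by auto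
  then obtain xs where "chain S' xs" "length xs \<le> t" "w \<in> hd xs" "last xs = g"
    using chain_of_paths[of S' X t w g] by blast
  moreover from * have "S' \<subseteq> S" "e \<in> S" by auto
  ultimately obtain ys where "chain S ys" "length ys = Suc (length xs)" "hd ys = e" "last ys = last xs"
    using chain_extend[of S' xs S e w] * by metis
  with * \<open>length xs \<le> t\<close> \<open>last xs = g\<close> show ?thesis
    by (intro exI[of _ ys]) simp
qed

section \<open>Random regular uniform hypergraphs\<close>

text \<open>The probability of reaching depth \<open>t\<close> in a tree where every vertex has
  \<open>M\<close> edges below it, each present independently with probability \<open>p\<close> and
  leading to \<open>r - 1\<close> further vertices.\<close>

fun path_bound :: "nat \<Rightarrow> nat \<Rightarrow> real \<Rightarrow> nat \<Rightarrow> real" where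
  "path_bound r M p 0 = 1"
| "path_bound r M p (Suc t) = 1 - (1 - p * (1 - (1 - path_bound r M p t) ^ (r - 1))) ^ M"

lemma path_bound_range:
  assumes "0 \<le> p" "p \<le> 1"
  shows "0 \<le> path_bound r M p t \<and> path_bound r M p t \<le> 1"
proof (induction t)
  case (Suc t)
  then have "0 \<le> 1 - (1 - path_bound r M p t) ^ (r - 1)" "1 - (1 - path_bound r M p t) ^ (r - 1) \<le> 1"
    by (auto intro: power_le_one)
  with assms have "0 \<le> p * (1 - (1 - path_bound r M p t) ^ (r - 1))"
      "p * (1 - (1 - path_bound r M p t) ^ (r - 1)) \<le> 1"
    by (auto intro: mult_le_one)
  then show ?case by (auto intro: power_le_one)
qed simp

definition branch_bound :: "nat \<Rightarrow> nat \<Rightarrow> real \<Rightarrow> nat \<Rightarrow> real" where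
  "branch_bound r M p t = p * (1 - (1 - path_bound r M p t) ^ (r - 1))"

lemma branch_bound_range:
  assumes "0 \<le> p" "p \<le> 1"
  shows "0 \<le> branch_bound r M p t" "branch_bound r M p t \<le> 1"
  using path_bound_range[OF assms, of r M t] assms unfolding branch_bound_def
  by (auto intro!: mult_le_one mult_nonneg_nonneg power_le_one)

text \<open>\<open>X\<close> is the set of possible edges, not the random outcome; \<open>M\<close>
  is the degree of a vertex in \<open>X\<close>.\<close>

locale random_hypergraph_system = random_subset X p for X :: "'v set set" and p :: real +
  fixes V :: "'v set" and r M :: nat
  assumes finite_V: "finite V"
    and edge_subset: "e \<in> X \<Longrightarrow> e \<subseteq> V"
    and card_edge: "e \<in> X \<Longrightarrow> card e = r"
    and degree: "u \<in> V \<Longrightarrow> card {e\<in>X. u \<in> e} = M"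
begin

lemma finite_edge: "e \<in> X \<Longrightarrow> finite e"
  using edge_subset finite_V finite_subset by blast

text \<open>The bound at length \<open>t\<close> is a hypothesis here because this lemma is half of
  the induction step of \<open>pr_paths_le\<close>. The exponent \<open>r - 1\<close> counts the
  vertices of \<open>e\<close> other than \<open>u\<close>.\<close>

lemma pr_branches_le_aux:
  assumes "\<And>w. w \<in> V \<Longrightarrow> pr (paths X t w) \<le> path_bound r M p t" "e \<in> X" "u \<in> e"
  shows "pr (branches X t u e) \<le> branch_bound r M p t"
proof -
  have "pr (branches X t u e) \<le> pr {{e}} * pr (\<Union>w\<in>e - {u}. paths X t w)"
    unfolding branches_def by (rule pr_disj_prod_le)
  also have "\<dots> = p * pr (\<Union>w\<in>e - {u}. paths X t w)"
    using assms by (simp add: pr_singleton)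
  also have "\<dots> \<le> p * (1 - (1 - path_bound r M p t) ^ card (e - {u}))"
    using assms edge_subset[of e] finite_edge[of e] p_nonneg p_le_1 path_bound_range[of p r M t]
    by (intro mult_left_mono pr_UN_le) auto
  finally show ?thesis
    using assms card_edge[of e] finite_edge[of e] by (simp add: branch_bound_def)
qed

lemma pr_paths_le: "u \<in> V \<Longrightarrow> pr (paths X t u) \<le> path_bound r M p t"
proof (induction t arbitrary: u)
  case 0
  then show ?case by simp
next
  case (Suc t)
  have "pr (paths X (Suc t) u) = pr (\<Union>e\<in>{e\<in>X. u \<in> e}. branches X t u e)"
    by (simp add: branches_def)
  also have "\<dots> \<le> 1 - (1 - branch_bound r M p t) ^ card {e\<in>X. u \<in> e}"
    using finite_X Suc.IH branch_bound_range[OF p_nonneg p_le_1]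
    by (intro pr_UN_le) (auto intro: pr_branches_le_aux)
  finally show ?case using Suc.prems by (simp add: degree branch_bound_def)
qed

lemma pr_branches_le: "e \<in> X \<Longrightarrow> u \<in> e \<Longrightarrow> pr (branches X t u e) \<le> branch_bound r M p t"
  by (rule pr_branches_le_aux) (auto intro: pr_paths_le)

lemma pr_vertex_wit_le:
  assumes "u \<in> V"
  shows "pr (vertex_wit X t u) \<le> at_least_two M (branch_bound r M p t)"
proof -
  have "pr (vertex_wit X t u) \<le> at_least_two (card {e\<in>X. u \<in> e}) (branch_bound r M p t)"
    unfolding vertex_wit_def using finite_X branch_bound_range[OF p_nonneg p_le_1]
    by (intro pr_disj_pairs_le) (auto intro: pr_branches_le)
  then show ?thesis using assms by (simp add: degree)
qed

lemma pr_edge_wit_le: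
  assumes "e \<in> X"
  shows "pr (edge_wit X t e) \<le> p * at_least_two r (path_bound r M p t)"
proof -
  have "pr (edge_wit X t e) \<le> pr {{e}} * pr (disj_pairs e (paths X t))"
    unfolding edge_wit_def by (rule pr_disj_prod_le)
  also have "\<dots> = p * pr (disj_pairs e (paths X t))"
    using assms by (simp add: pr_singleton)
  also have "\<dots> \<le> p * at_least_two (card e) (path_bound r M p t)"
    using assms edge_subset[of e] finite_edge[of e] p_nonneg p_le_1 path_bound_range[of p r M t]
    by (intro mult_left_mono pr_disj_pairs_le) (auto intro: pr_paths_le)
  finally show ?thesis
    using assms by (simp add: card_edge)
qed

section \<open>Counting chains and bounding overlaps\<close>

lemma card_chains_le:
  "finite {xs. chain X xs \<and> length xs = Suc k} \<and>
   card {xs. chain X xs \<and> length xs = Suc k} \<le> card X * (r * M) ^ k"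
proof (induction k)
  case 0
  have "{xs. chain X xs \<and> length xs = Suc 0} = (\<lambda>e. [e]) ` X"
    by (auto simp: chain_def length_Suc_conv)
  then show ?case using finite_X card_image_le[of X "\<lambda>e. [e]"] by simp
next
  case (Suc k)
  let ?C = "{xs. chain X xs \<and> length xs = Suc k}"
  have sub: "{xs. chain X xs \<and> length xs = Suc (Suc k)}
      \<subseteq> (\<Union>xs\<in>?C. (\<lambda>e. e # xs) ` {e\<in>X. e \<inter> hd xs \<noteq> {}})"
  proof
    fix ys assume "ys \<in> {xs. chain X xs \<and> length xs = Suc (Suc k)}"
    then obtain e xs where ys: "ys = e # xs" "length xs = Suc k" "chain X (e # xs)"
      by (cases ys) auto
    then have "e \<in> X" "e \<inter> hd xs \<noteq> {}" "chain X xs"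
      by (auto simp: chain_Cons)
    with ys show "ys \<in> (\<Union>xs\<in>?C. (\<lambda>e. e # xs) ` {e\<in>X. e \<inter> hd xs \<noteq> {}})"
      by blast
  qed
  have deg: "card ((\<lambda>e. e # xs) ` {e\<in>X. e \<inter> hd xs \<noteq> {}}) \<le> r * M" if "xs \<in> ?C" for xs
  proof -
    have hd: "hd xs \<in> X" using that by (cases xs) (auto simp: chain_def)
    have "card ((\<lambda>e. e # xs) ` {e\<in>X. e \<inter> hd xs \<noteq> {}}) \<le> card {e\<in>X. e \<inter> hd xs \<noteq> {}}"
      using finite_X by (intro card_image_le) auto
    also have "\<dots> \<le> card (\<Union>u\<in>hd xs. {e\<in>X. u \<in> e})"
      using finite_X finite_edge[OF hd] by (intro card_mono) auto
    also have "\<dots> \<le> (\<Sum>u\<in>hd xs. card {e\<in>X. u \<in> e})"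
      using finite_edge[OF hd] by (intro card_UN_le)
    also have "\<dots> = (\<Sum>u\<in>hd xs. M)"
      using edge_subset[OF hd] by (intro sum.cong) (auto simp: degree)
    also have "\<dots> = r * M" using card_edge[OF hd] by simp
    finally show ?thesis .
  qed
  let ?U = "\<Union>xs\<in>?C. (\<lambda>e. e # xs) ` {e\<in>X. e \<inter> hd xs \<noteq> {}}"
  have fin: "finite ?U"
    using Suc finite_X by auto
  have "card ?U \<le> (\<Sum>xs\<in>?C. card ((\<lambda>e. e # xs) ` {e\<in>X. e \<inter> hd xs \<noteq> {}}))"
    using Suc by (intro card_UN_le) auto
  also have "\<dots> \<le> card ?C * (r * M)"
    using deg by (intro sum_bounded_above[where 'a = nat, simplified]) auto
  also have "\<dots> \<le> card X * (r * M) ^ Suc k"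
    using Suc by (metis mult.assoc mult.commute mult_le_mono1 power_Suc)
  finally show ?case
    using card_mono[OF fin sub] finite_subset[OF sub fin] by linarith
qed

text \<open>Bounds the expected number of chains of at most \<open>2 * K\<close> distinct edges that
  are present; \<open>k + 1\<close> is the number of edges. It is linear in \<open>n\<close> for
  fixed \<open>K\<close> as long as \<open>card X * p\<close> is linear and \<open>M * p\<close>
  bounded.\<close>

definition overlap_bound :: "nat \<Rightarrow> real" where
  "overlap_bound K = (\<Sum>k<2 * K. real (card X) * p * (real r * (real M * p)) ^ k)"

text \<open>If witnesses of \<open>i\<close> and \<open>j\<close> share an edge, the chains leading
  to it from both sides join to one chain of at most \<open>2 * K\<close> edges. The set
  \<open>\<phi> e\<close> contains the indices that a chain starting with \<open>e\<close> can
  serve: the vertices of \<open>e\<close> when indices are vertices, only \<open>e\<close> itself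
  when they are edges.\<close>

lemma sum_pr_overlaps_le:
  assumes "finite I" "\<And>e. e \<in> X \<Longrightarrow> finite (\<phi> e) \<and> card (\<phi> e) \<le> c"
    and reach: "\<And>i S g. i \<in> I \<Longrightarrow> S \<in> W i \<Longrightarrow> g \<in> S \<Longrightarrow>
      \<exists>xs. chain S xs \<and> length xs \<le> K \<and> i \<in> \<phi> (hd xs) \<and> last xs = g"
  shows "(\<Sum>i\<in>I. \<Sum>j\<in>I. pr (overlaps (W i) (W j))) \<le> real (c * c) * overlap_bound K"
proof -
  define C where "C = {xs. chain X xs \<and> distinct xs \<and> length xs \<le> 2 * K}"
  define D where "D k = {xs. chain X xs \<and> length xs = Suc k}" for k
  have D: "finite (D k)" "card (D k) \<le> card X * (r * M) ^ k" for k
    using card_chains_le[of k] by (simp_all add: D_def)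
  have C_sub: "C = (\<Union>k\<in>{..<2 * K}. {xs\<in>D k. distinct xs})"
  proof (intro set_eqI)
    fix xs :: "'v set list"
    show "xs \<in> C \<longleftrightarrow> xs \<in> (\<Union>k\<in>{..<2 * K}. {xs\<in>D k. distinct xs})"
      by (cases xs) (auto simp: C_def D_def chain_def)
  qed
  have finC: "finite C" unfolding C_sub using D by auto
  have point: "(\<Sum>i\<in>I. \<Sum>j\<in>I. of_bool (occurs (overlaps (W i) (W j)) \<omega>))
      \<le> real (c * c) * (\<Sum>xs\<in>C. of_bool (set xs \<subseteq> \<omega>))" if "\<omega> \<subseteq> X" for \<omega>
  proof -
    let ?P = "{ij\<in>I \<times> I. occurs (overlaps (W (fst ij)) (W (snd ij))) \<omega>}"
    let ?D = "{xs\<in>C. set xs \<subseteq> \<omega>}"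
    \<comment> \<open>Each overlapping pair is charged to a chain of distinct present edges, whose
      two ends leave at most \<open>c * c\<close> choices for the pair.\<close>
    have "?P \<subseteq> (\<Union>xs\<in>?D. \<phi> (hd xs) \<times> \<phi> (last xs))"
    proof safe
      fix i j assume ij: "i \<in> I" "j \<in> I"
        and "occurs (overlaps (W (fst (i, j))) (W (snd (i, j)))) \<omega>"
      then obtain S T g where ST: "S \<in> W i" "T \<in> W j" "g \<in> S" "g \<in> T" "S \<subseteq> \<omega>" "T \<subseteq> \<omega>"
        unfolding occurs_def overlaps_def by auto
      obtain xs where xs: "chain S xs" "length xs \<le> K" "i \<in> \<phi> (hd xs)" "last xs = g"
        using reach ij ST by metis
      obtain ys where ys: "chain T ys" "length ys \<le> K" "j \<in> \<phi> (hd ys)" "last ys = g"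
        using reach ij ST by metis
      have "chain \<omega> xs" "chain \<omega> ys" using xs ys ST chain_mono by blast+
      then obtain zs where zs: "chain \<omega> zs" "length zs \<le> length xs + length ys" "hd zs = hd xs" "last zs = hd ys"
        using chain_join[of \<omega> xs ys] xs ys by auto
      then obtain zs' where "chain \<omega> zs'" "distinct zs'" "length zs' \<le> length zs" "hd zs' = hd zs" "last zs' = last zs"
        using chain_distinct by blast
      with zs xs ys that show "(i, j) \<in> (\<Union>xs\<in>?D. \<phi> (hd xs) \<times> \<phi> (last xs))"
        unfolding C_def by (intro UN_I[of zs']) (auto simp: chain_def)
    qed
    moreover have bd: "finite (\<phi> (hd xs) \<times> \<phi> (last xs)) \<and> card (\<phi> (hd xs) \<times> \<phi> (last xs)) \<le> c * c"
      if "xs \<in> ?D" for xs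
    proof -
      have "hd xs \<in> X" "last xs \<in> X"
        using that unfolding C_def chain_def by (auto intro!: subsetD[of "set xs" X])
      then show ?thesis using assms(2) by (simp add: card_cartesian_product mult_le_mono)
    qed
    ultimately have "card ?P \<le> card (\<Union>xs\<in>?D. \<phi> (hd xs) \<times> \<phi> (last xs))"
      using finC by (intro card_mono) auto
    also have "\<dots> \<le> (\<Sum>xs\<in>?D. card (\<phi> (hd xs) \<times> \<phi> (last xs)))"
      using finC by (intro card_UN_le) auto
    also have "\<dots> \<le> (\<Sum>xs\<in>?D. c * c)"
      using bd by (intro sum_mono) blast
    finally have "card ?P \<le> c * c * card ?D" by (simp add: mult.commute)
    then have "real (card ?P) \<le> real (c * c) * real (card ?D)"
      unfolding of_nat_mult[symmetric] of_nat_le_iff .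
    moreover have "(\<Sum>i\<in>I. \<Sum>j\<in>I. of_bool (occurs (overlaps (W i) (W j)) \<omega>)) = real (card ?P)"
      unfolding sum.cartesian_product case_prod_unfold
      using assms(1) by (simp add: of_bool_def sum.If_cases Int_def)
    moreover have "(\<Sum>xs\<in>C. of_bool (set xs \<subseteq> \<omega>)) = real (card ?D)"
      using finC by (simp add: of_bool_def sum.If_cases Int_def)
    ultimately show ?thesis by simp
  qed
  have "(\<Sum>i\<in>I. \<Sum>j\<in>I. pr (overlaps (W i) (W j))) =
      bexp X p (\<lambda>\<omega>. \<Sum>i\<in>I. \<Sum>j\<in>I. of_bool (occurs (overlaps (W i) (W j)) \<omega>))"
    by (simp add: bexp_sum pr_def)
  also have "\<dots> \<le> bexp X p (\<lambda>\<omega>. real (c * c) * (\<Sum>xs\<in>C. of_bool (set xs \<subseteq> \<omega>)))"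
    by (intro mono point)
  also have "\<dots> = real (c * c) * (\<Sum>xs\<in>C. bexp X p (\<lambda>\<omega>. of_bool (set xs \<subseteq> \<omega>)))"
    by (simp only: bexp_cmult bexp_sum)
  also have "(\<Sum>xs\<in>C. bexp X p (\<lambda>\<omega>. of_bool (set xs \<subseteq> \<omega>))) = (\<Sum>xs\<in>C. p ^ length xs)"
    using finite_X by (intro sum.cong) (auto simp: bexp_subset C_def chain_def distinct_card)
  also have "\<dots> \<le> overlap_bound K"
  proof -
    have "(\<Sum>xs\<in>C. p ^ length xs) =
        (\<Sum>k<2 * K. \<Sum>xs\<in>{xs\<in>D k. distinct xs}. p ^ length xs)"
      unfolding C_sub
    proof (intro sum.UNION_disjoint ballI impI)
      show "finite {xs\<in>D k. distinct xs}" for k using D(1)[of k] by simp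
      show "{xs\<in>D j. distinct xs} \<inter> {xs\<in>D k. distinct xs} = {}" if "j \<noteq> k" for j k
        using that by (auto simp: D_def)
    qed simp
    also have "\<dots> = (\<Sum>k<2 * K. real (card {xs\<in>D k. distinct xs}) * p ^ Suc k)"
      by (intro sum.cong) (auto simp: D_def)
    also have "\<dots> \<le> (\<Sum>k<2 * K. real (card X * (r * M) ^ k) * p ^ Suc k)"
    proof (intro sum_mono mult_right_mono)
      fix k
      have "card {xs\<in>D k. distinct xs} \<le> card (D k)"
        using D by (intro card_mono) auto
      also have "\<dots> \<le> card X * (r * M) ^ k" using D by blast
      finally show "real (card {xs\<in>D k. distinct xs}) \<le> real (card X * (r * M) ^ k)"
        by (rule of_nat_mono)
    qed (use p_nonneg in auto)
    also have "\<dots> = overlap_bound K"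
      unfolding overlap_bound_def by (simp add: power_mult_distrib mult_ac)
    finally show ?thesis .
  qed
  finally show ?thesis by (simp add: mult_left_mono)
qed

end

section \<open>Witnesses along a loose cycle\<close>

text \<open>The window starts at an arbitrary \<open>k\<close> so that the rest of the path is again
  of this form.\<close>

lemma paths_of_sequence:
  assumes "\<And>j. k \<le> j \<Longrightarrow> j < k + t \<Longrightarrow> y j \<in> X \<and> x j \<in> y j \<and> x (Suc j) \<in> y j \<and> x j \<noteq> x (Suc j)"
    and "inj_on y {k..<k + t}"
  shows "y ` {k..<k + t} \<in> paths X t (x k)"
  using assms
proof (induction t arbitrary: k)
  case (Suc t)
  have k: "y k \<in> X" "x k \<in> y k" "x (Suc k) \<in> y k - {x k}"
    using Suc.prems(1)[of k] by auto
  have split: "{k..<k + Suc t} = insert k {Suc k..<Suc k + t}" by auto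
  have "y ` {Suc k..<Suc k + t} \<in> paths X t (x (Suc k))"
    using Suc.prems by (intro Suc.IH) (auto intro: inj_on_subset)
  moreover have "{y k} \<inter> y ` {Suc k..<Suc k + t} = {}"
    using Suc.prems(2) unfolding split by (auto simp: inj_on_def)
  ultimately have "{y k} \<union> y ` {Suc k..<Suc k + t} \<in> {{y k}} \<odot> (\<Union>w\<in>y k - {x k}. paths X t w)"
    using k unfolding disj_prod_def by blast
  then show ?case
    using k unfolding split by auto
qed simp

lemma branches_of_sequence:
  assumes "\<And>j. j \<le> t \<Longrightarrow> y j \<in> X \<and> x j \<in> y j \<and> x (Suc j) \<in> y j \<and> x j \<noteq> x (Suc j)"
    and "inj_on y {..t}"
  shows "y ` {..t} \<in> branches X t (x 0) (y 0)"
proof -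
  have split: "{..t} = insert 0 {1..<1 + t}" by auto
  have "y ` {1..<1 + t} \<in> paths X t (x 1)"
    using assms by (intro paths_of_sequence) (auto intro: inj_on_subset)
  moreover have "{y 0} \<inter> y ` {1..<1 + t} = {}"
    using assms(2) unfolding split by (auto simp: inj_on_def)
  moreover have "x 1 \<in> y 0 - {x 0}" using assms(1)[of 0] by auto
  ultimately have "{y 0} \<union> y ` {1..<1 + t} \<in> branches X t (x 0) (y 0)"
    unfolding disj_prod_def branches_def by blast
  then show ?thesis unfolding split by simp
qed

text \<open>What is kept of a loose cycle: its joints \<open>x\<close> and edges \<open>y\<close>,
  extended periodically to all natural numbers. Stretches across the closing vertex are then
  ordinary windows of indices.\<close>

locale edge_cycle =
  fixes E X :: "'v set set" and x :: "nat \<Rightarrow> 'v" and y :: "nat \<Rightarrow> 'v set" and l :: nat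
  assumes E_subset: "E \<subseteq> X"
    and y_in: "y j \<in> E" and x_in: "x j \<in> y j" "x (Suc j) \<in> y j" and x_neq: "x j \<noteq> x (Suc j)"
    and y_inj: "y j = y k \<Longrightarrow> j mod l = k mod l" and x_periodic: "x (j + l) = x j"
begin

lemma y_window:
  assumes "y j = y k" "i \<le> j" "j < i + l" "i \<le> k" "k < i + l"
  shows "j = k"
proof -
  have "int l dvd int j - int k"
    using y_inj[OF assms(1)] by (metis mod_eq_dvd_iff of_nat_mod)
  moreover have "\<bar>int j - int k\<bar> < int l" using assms by auto
  ultimately show ?thesis using zdvd_not_zless[of "\<bar>int j - int k\<bar>" "int l"] by auto
qed

text \<open>The cycle read backwards from \<open>x i\<close>. Adding one period prevents truncated
  subtraction, and the \<open>- 1\<close> makes \<open>back_y i j\<close> the edge between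
  \<open>back_x i j\<close> and \<open>back_x i (Suc j)\<close>.\<close>

definition "back_x i j = x (i + l - j)"
definition "back_y i j = y (i + l - 1 - j)"

lemma back_step:
  assumes "j < l"
  shows "back_y i j \<in> E \<and> back_x i j \<in> back_y i j \<and> back_x i (Suc j) \<in> back_y i j \<and> back_x i j \<noteq> back_x i (Suc j)"
proof -
  have "i + l - j = Suc (i + l - 1 - j)" using assms by auto
  then show ?thesis
    using y_in x_in x_neq unfolding back_x_def back_y_def by (metis Suc_diff_Suc diff_Suc_1 diff_Suc_eq_diff_pred diff_commute)
qed

lemma inj_forward: "inj_on y {i..<i + l}"
  using y_window[of _ _ i] by (auto simp: inj_on_def)

lemma inj_back: "inj_on (back_y i) {..<l}"
proof (rule inj_onI)
  fix j k assume *: "j \<in> {..<l}" "k \<in> {..<l}" "back_y i j = back_y i k"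
  then have "i + l - 1 - j = i + l - 1 - k"
    by (intro y_window[of _ _ i]) (auto simp: back_y_def)
  with * show "j = k" by auto
qed

lemma forward_back_disjoint:
  assumes "i \<le> j" "j + k < i + l - 1" "k < l"
  shows "y j \<noteq> back_y i k"
proof
  assume "y j = back_y i k"
  then have "j = i + l - 1 - k"
    using assms by (intro y_window[of _ _ i]) (auto simp: back_y_def)
  with assms show False by linarith
qed

text \<open>The \<open>t + 1\<close> edges after the joint and the \<open>t + 1\<close> edges before
  it are disjoint exactly because \<open>l\<close> leaves room for \<open>2 * t + 2\<close>
  edges.\<close>

lemma occurs_vertex_wit:
  assumes "2 * t + 2 \<le> l"
  shows "occurs (vertex_wit X t (x i)) E"
proof -
  let ?S = "(\<lambda>j. y (i + j)) ` {..t}" and ?T = "back_y i ` {..t}"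
  have S: "?S \<in> branches X t (x i) (y i)"
  proof -
    have "inj_on (\<lambda>j. y (i + j)) {..t}"
    proof (rule inj_onI)
      fix j k assume "j \<in> {..t}" "k \<in> {..t}" "y (i + j) = y (i + k)"
      then have "i + j = i + k" using assms by (intro y_window[of _ _ i]) auto
      then show "j = k" by simp
    qed
    moreover have "y (i + j) \<in> X" for j using y_in E_subset by blast
    ultimately show ?thesis
      using branches_of_sequence[of t "\<lambda>j. y (i + j)" X "\<lambda>j. x (i + j)"] x_in x_neq by simp
  qed
  have T: "?T \<in> branches X t (x i) (back_y i 0)"
  proof -
    have "inj_on (back_y i) {..t}"
      using assms by (intro inj_on_subset[OF inj_back]) auto
    moreover have "back_y i j \<in> X \<and> back_x i j \<in> back_y i j \<and> back_x i (Suc j) \<in> back_y i j \<and>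
        back_x i j \<noteq> back_x i (Suc j)" if "j \<le> t" for j
      using back_step[of j i] that assms E_subset by auto
    ultimately have "?T \<in> branches X t (back_x i 0) (back_y i 0)"
      by (intro branches_of_sequence) auto
    then show ?thesis by (simp add: back_x_def x_periodic)
  qed
  have disj: "?S \<inter> ?T = {}"
  proof -
    have "y (i + j) \<noteq> back_y i k" if "j \<le> t" "k \<le> t" for j k
      using that assms by (intro forward_back_disjoint) auto
    then show ?thesis by auto
  qed
  have "i + 0 < i + l - 1" "0 < l" using assms by linarith+
  then have "back_y i 0 \<in> X" "x i \<in> back_y i 0" "back_y i 0 \<noteq> y i"
    using back_step[of 0 i] forward_back_disjoint[of i i 0] E_subset x_periodic
    by (auto simp: back_x_def)
  moreover have "y i \<in> X" "x i \<in> y i" using y_in x_in E_subset by auto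
  moreover have "?S \<union> ?T \<in> branches X t (x i) (y i) \<odot> branches X t (x i) (back_y i 0)"
    using S T disj unfolding disj_prod_def by blast
  ultimately have "?S \<union> ?T \<in> vertex_wit X t (x i)"
    unfolding vertex_wit_def disj_pairs_def by (intro UN_I[of "y i"] UN_I[of "back_y i 0"]) auto
  moreover have "?S \<union> ?T \<subseteq> E"
    using y_in by (auto simp: back_y_def)
  ultimately show ?thesis unfolding occurs_def by blast
qed

text \<open>The path forward leaves \<open>y i\<close> at \<open>x (Suc i)\<close>, the path
  backward at \<open>x i\<close>; with \<open>y i\<close> itself they use \<open>2 * t + 1\<close>
  edges.\<close>

lemma occurs_edge_wit:
  assumes "2 * t + 2 \<le> l"
  shows "occurs (edge_wit X t (y i)) E"
proof -
  let ?S = "y ` {Suc i..<Suc i + t}" and ?T = "back_y i ` {0..<0 + t}"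
  have S: "?S \<in> paths X t (x (Suc i))"
    using y_in x_in x_neq E_subset assms
    by (intro paths_of_sequence inj_on_subset[OF inj_forward[of i]]) auto
  have "?T \<in> paths X t (back_x i 0)"
    using back_step[of _ i] E_subset assms
    by (intro paths_of_sequence inj_on_subset[OF inj_back[of i]]) auto
  then have T: "?T \<in> paths X t (x i)" by (simp add: back_x_def x_periodic)
  have disj: "?S \<inter> ?T = {}"
  proof -
    have "y j \<noteq> back_y i k" if "Suc i \<le> j" "j < Suc i + t" "k < t" for j k
      using that assms by (intro forward_back_disjoint) auto
    then show ?thesis by fastforce
  qed
  have "?S \<union> ?T \<in> paths X t (x (Suc i)) \<odot> paths X t (x i)"
    using S T disj unfolding disj_prod_def by blast
  then have "?S \<union> ?T \<in> disj_pairs (y i) (paths X t)"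
    unfolding disj_pairs_def using x_in[of i] x_neq[of i]
    by (intro UN_I[of "x (Suc i)"] UN_I[of "x i"]) auto
  moreover have "{y i} \<inter> (?S \<union> ?T) = {}"
  proof -
    have "y i \<noteq> back_y i k" if "k < t" for k
      using that assms by (intro forward_back_disjoint) auto
    moreover have "y i \<noteq> y j" if "Suc i \<le> j" "j < Suc i + t" for j
      using y_window[of i j i] that assms by auto
    ultimately show ?thesis by fastforce
  qed
  ultimately have "{y i} \<union> (?S \<union> ?T) \<in> edge_wit X t (y i)"
    unfolding edge_wit_def disj_prod_def by blast
  moreover have "{y i} \<union> (?S \<union> ?T) \<subseteq> E"
    using y_in by (auto simp: back_y_def)
  ultimately show ?thesis unfolding occurs_def by blast
qed

end

lemma edge_cycle_of_loose_cycle: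
  assumes "loose_cycle r V E l v e" "r \<ge> 3" "l \<ge> 2" "E \<subseteq> X"
  shows "edge_cycle E X (\<lambda>j. v (j mod l * (r - 1) + 1)) (\<lambda>j. e (j mod l + 1)) l"
    and "inj_on (\<lambda>j. v (j mod l * (r - 1) + 1)) {..<l}"
proof -
  define s where "s = r - 1"
  have s: "s \<ge> 2" "r = Suc s" using assms(2) by (auto simp: s_def)
  have inj: "inj_on v {1..l * s}" and close: "v (l * s + 1) = v 1"
    using assms(1) by (auto simp: loose_cycle_def s_def)
  have e: "e (i + 1) = v ` {i * s + 1..i * s + s + 1} \<and> e (i + 1) \<in> E" if "i < l" for i
  proof -
    have "e (i + 1) = v ` {(i + 1 - 1) * (r - 1) + 1..(i + 1 - 1) * (r - 1) + r} \<and> e (i + 1) \<in> E"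
      using assms(1) that unfolding loose_cycle_def by (elim conjE) (erule bspec, simp)
    then show ?thesis unfolding s_def[symmetric] by (auto simp: s(2))
  qed
  have joint_le: "i * s + s \<le> l * s" if "i < l" for i
    using that by (metis Suc_leI add.commute mult_Suc mult_le_mono1)
  have joint_inj: "i = j" if "v (i * s + 1) = v (j * s + 1)" "i < l" "j < l" for i j
  proof -
    have "i * s + 1 = j * s + 1"
      using that joint_le[of i] joint_le[of j] s by (intro inj_onD[OF inj that(1)]) auto
    then show ?thesis using s by auto
  qed
  have edge_inj: "\<not> i < j" if h: "e (i + 1) = e (j + 1)" "i < l" "j < l" for i j
  proof
    assume "i < j"
    then have le: "i * s + s \<le> j * s"
      by (metis Suc_leI add.commute mult_Suc mult_le_mono1)
    \<comment> \<open>Since \<open>s \<ge> 2\<close>, position \<open>i * s + 2\<close> is not the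
      first position of a later edge but lies in the interior of, or ends at most, this one; as
      \<open>s + 1\<close> is the last position, it precedes all later edges and cannot recur in
      them.\<close>
    have "v (i * s + 2) \<in> e (j + 1)"
      unfolding h(1)[symmetric] using e[OF h(2)] s by auto
    then obtain k where k: "v (i * s + 2) = v k" "j * s + 1 \<le> k" "k \<le> j * s + s + 1"
      using e[OF h(3)] by auto
    have i2: "i * s + 2 \<in> {1..l * s}" using joint_le[OF h(2)] s by auto
    show False
    \<comment> \<open>The last edge may reach position \<open>l * s + 1\<close>, which lies outside
      the range of injectivity and is identified with position 1.\<close>
    proof (cases "k \<le> l * s")
      case True
      then have "i * s + 2 = k" using k i2 by (intro inj_onD[OF inj k(1)]) auto
      with k le s show False by linarith
    next
      case False
      then have "k = l * s + 1" using k joint_le[OF h(3)] by linarith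
      with k close have "v (i * s + 2) = v 1" by simp
      moreover have "1 \<in> {1..l * s}" using i2 unfolding atLeastAtMost_iff by linarith
      ultimately have "i * s + 2 = 1" using i2 by (intro inj_onD[OF inj])
      then show False by simp
    qed
  qed
  have lt: "j mod l < l" for j using assms(3) by simp
  have next_mem: "v (Suc j mod l * s + 1) \<in> e (j mod l + 1)" for j
  proof (cases "Suc (j mod l) = l")
    case True
    then have "Suc j mod l = 0" by (simp add: mod_Suc)
    moreover have "l * s = j mod l * s + s" using True by (metis add.commute mult_Suc)
    moreover have "v (j mod l * s + s + 1) \<in> e (j mod l + 1)" using e[OF lt, of j] by auto
    ultimately show ?thesis using close by simp
  next
    case False
    then have "Suc j mod l = Suc (j mod l)" by (simp add: mod_Suc)
    then show ?thesis using e[OF lt, of j] s by auto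
  qed
  show "edge_cycle E X (\<lambda>j. v (j mod l * (r - 1) + 1)) (\<lambda>j. e (j mod l + 1)) l"
    unfolding s_def[symmetric]
  proof
    show "E \<subseteq> X" by fact
    show "e (j mod l + 1) \<in> E" for j using e[OF lt] by blast
    show "v (j mod l * s + 1) \<in> e (j mod l + 1)" for j using e[OF lt, of j] by auto
    show "v (Suc j mod l * s + 1) \<in> e (j mod l + 1)" for j by (rule next_mem)
    show "v (j mod l * s + 1) \<noteq> v (Suc j mod l * s + 1)" for j
    proof
      assume "v (j mod l * s + 1) = v (Suc j mod l * s + 1)"
      then have "j mod l = Suc j mod l" using lt by (intro joint_inj) auto
      then show False using assms(3) by (auto simp: mod_Suc split: if_splits)
    qed
    show "j mod l = k mod l" if "e (j mod l + 1) = e (k mod l + 1)" for j k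
      using edge_inj[OF that] edge_inj[OF that[symmetric]] lt by (meson linorder_neqE_nat)
    show "v ((j + l) mod l * s + 1) = v (j mod l * s + 1)" for j by simp
  qed
  show "inj_on (\<lambda>j. v (j mod l * (r - 1) + 1)) {..<l}"
    unfolding s_def[symmetric] using joint_inj by (auto simp: inj_on_def)
qed

text \<open>Only joints are counted among the vertices, one per edge, as they are the vertices lying
  on two edges of the cycle.\<close>

lemma loose_cycle_length_le:
  assumes "loose_cycle r V E l v e" "r \<ge> 3" "2 * t + 2 \<le> l" "E \<subseteq> X" "finite V" "finite X"
  shows "l \<le> card {u\<in>V. occurs (vertex_wit X t u) E}"
    and "l \<le> card {f\<in>X. occurs (edge_wit X t f) E}"
proof -
  let ?x = "\<lambda>j. v (j mod l * (r - 1) + 1)" and ?y = "\<lambda>j. e (j mod l + 1)"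
  have l: "l \<ge> 2" using assms(3) by simp
  interpret edge_cycle E X ?x ?y l
    by (rule edge_cycle_of_loose_cycle[OF assms(1,2) l assms(4)])
  have "?x j \<in> V" if "j < l" for j
  proof -
    have "j * (r - 1) + 1 \<le> l * (r - 1) + 1" using that by simp
    then show ?thesis using assms(1) that unfolding loose_cycle_def by auto
  qed
  then have "?x j \<in> {u\<in>V. occurs (vertex_wit X t u) E}" if "j < l" for j
    using occurs_vertex_wit[OF assms(3), of j] that by simp
  then have "?x ` {..<l} \<subseteq> {u\<in>V. occurs (vertex_wit X t u) E}"
    by blast
  then have "card (?x ` {..<l}) \<le> card {u\<in>V. occurs (vertex_wit X t u) E}"
    using assms(5) by (intro card_mono) auto
  then show "l \<le> card {u\<in>V. occurs (vertex_wit X t u) E}"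
    unfolding card_image[OF edge_cycle_of_loose_cycle(2)[OF assms(1,2) l assms(4)]] by simp
  have "?y ` {..<l} \<subseteq> {f\<in>X. occurs (edge_wit X t f) E}"
    using occurs_edge_wit[OF assms(3)] y_in E_subset by blast
  then have "card (?y ` {..<l}) \<le> card {f\<in>X. occurs (edge_wit X t f) E}"
    using assms(6) by (intro card_mono) auto
  moreover have "inj_on ?y {..<l}"
    using inj_forward[of 0] unfolding lessThan_atLeast0 add_0 .
  ultimately show "l \<le> card {f\<in>X. occurs (edge_wit X t f) E}"
    using card_image[of ?y "{..<l}"] by (metis card_lessThan)
qed

section \<open>Tail bounds for fixed \<open>n\<close>\<close>

lemma card_all_edges: "card (all_edges r n) = n choose r"
  using n_subsets[of "{1..n}" r] by (simp add: all_edges_def)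

lemma card_edges_containing:
  assumes "u \<in> {1..n}" "1 \<le> r"
  shows "card {e\<in>all_edges r n. u \<in> e} = (n - 1) choose (r - 1)"
proof -
  let ?A = "{1..n} - {u}"
  let ?B = "{e. e \<subseteq> ?A \<and> card e = r - 1}"
  have "{e\<in>all_edges r n. u \<in> e} = insert u ` ?B"
  proof (intro equalityI subsetI)
    fix e assume "e \<in> {e\<in>all_edges r n. u \<in> e}"
    then have e: "e \<subseteq> {1..n}" "card e = r" "u \<in> e" by (auto simp: all_edges_def)
    then have "e - {u} \<in> ?B" by auto
    moreover have "e = insert u (e - {u})" using e by blast
    ultimately show "e \<in> insert u ` ?B" by blast
  next
    fix e assume "e \<in> insert u ` ?B"
    then obtain f where f: "f \<subseteq> ?A" "card f = r - 1" "e = insert u f" by auto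
    then have "finite f" "u \<notin> f" using finite_subset[of f ?A] by auto
    with f assms show "e \<in> {e\<in>all_edges r n. u \<in> e}"
      by (auto simp: all_edges_def)
  qed
  moreover have "inj_on (insert u) ?B" by (auto simp: inj_on_def)
  ultimately have "card {e\<in>all_edges r n. u \<in> e} = card ?B" by (simp add: card_image)
  also have "\<dots> = card ?A choose (r - 1)" by (intro n_subsets) simp
  finally show ?thesis using assms(1) by simp
qed

lemma random_hypergraph_system_all_edges:
  assumes "0 \<le> p" "p \<le> 1" "1 \<le> r"
  shows "random_hypergraph_system (all_edges r n) p {1..n} r ((n - 1) choose (r - 1))"
proof
  show "finite (all_edges r n)"
    by (rule finite_subset[of _ "Pow {1..n}"]) (auto simp: all_edges_def)
qed (use assms card_edges_containing in \<open>auto simp: all_edges_def\<close>)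

lemma longest_loose_cycle_le:
  assumes "r \<ge> 3" "E \<subseteq> X" "finite V" "finite X" "2 * t + 2 \<le> longest_loose_cycle r V E"
  shows "longest_loose_cycle r V E \<le> card {u\<in>V. occurs (vertex_wit X t u) E}"
    and "longest_loose_cycle r V E \<le> card {f\<in>X. occurs (edge_wit X t f) E}"
proof -
  let ?L = "{l. \<exists>v e. loose_cycle r V E l v e}"
  have "Max (insert 0 ?L) \<in> insert 0 ?L"
    using finite_loose_cycle_lengths[of V r E] assms by (intro Max_in) auto
  \<comment> \<open>The maximum is at least 2, so it is not the default value 0 and is attained by
    an actual cycle.\<close>
  then obtain v e where "loose_cycle r V E (longest_loose_cycle r V E) v e"
    using assms(5) unfolding longest_loose_cycle_def by auto
  then show "longest_loose_cycle r V E \<le> card {u\<in>V. occurs (vertex_wit X t u) E}"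
    and "longest_loose_cycle r V E \<le> card {f\<in>X. occurs (edge_wit X t f) E}"
    using loose_cycle_length_le[of r V E _ v e t X] assms by blast+
qed

context
  fixes r n t :: nat and p a :: real
  assumes p: "0 \<le> p" "p \<le> 1" and r: "3 \<le> r" and a: "0 < a"
begin

interpretation random_hypergraph_system "all_edges r n" p "{1..n}" r "(n - 1) choose (r - 1)"
  using p r by (intro random_hypergraph_system_all_edges) auto

lemma overlap_bound_all_edges:
  "overlap_bound K = (\<Sum>k<2 * K. real (n choose r) * p * (real r * (real ((n - 1) choose (r - 1)) * p)) ^ k)"
  unfolding overlap_bound_def card_all_edges ..

lemma prob_longest_tail:
  assumes "finite I" "(\<Sum>i\<in>I. pr (W i)) \<le> m"
    and "\<And>E. E \<subseteq> all_edges r n \<Longrightarrow> 2 * t + 2 \<le> longest_loose_cycle r {1..n} E \<Longrightarrow>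
      longest_loose_cycle r {1..n} E \<le> card {i\<in>I. occurs (W i) E}"
  shows "measure_pmf.prob (random_hypergraph r n p)
      {E. 2 * t + 2 \<le> longest_loose_cycle r {1..n} E \<and> m + a < real (longest_loose_cycle r {1..n} E)}
    \<le> (\<Sum>i\<in>I. \<Sum>j\<in>I. pr (overlaps (W i) (W j))) / a\<^sup>2"
proof -
  have "measure_pmf.prob (random_hypergraph r n p)
      {E. 2 * t + 2 \<le> longest_loose_cycle r {1..n} E \<and> m + a < real (longest_loose_cycle r {1..n} E)}
    \<le> bexp (all_edges r n) p (\<lambda>\<omega>. of_bool (m + a < (\<Sum>i\<in>I. of_bool (occurs (W i) \<omega>))))"
    unfolding random_hypergraph_def prob_Pi_pmf_eq_bexp[OF finite_X p]
  proof (intro mono)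
    fix E assume E: "E \<subseteq> all_edges r n"
    have "(\<Sum>i\<in>I. of_bool (occurs (W i) E)) = real (card {i\<in>I. occurs (W i) E})"
      using assms(1) by (simp add: of_bool_def sum.If_cases Int_def)
    then show "(of_bool (E \<in> {E. 2 * t + 2 \<le> longest_loose_cycle r {1..n} E \<and>
          m + a < real (longest_loose_cycle r {1..n} E)}) :: real)
        \<le> of_bool (m + a < (\<Sum>i\<in>I. of_bool (occurs (W i) E)))"
      using assms(3)[OF E] by auto
  qed
  also have "\<dots> \<le> (\<Sum>i\<in>I. \<Sum>j\<in>I. pr (overlaps (W i) (W j))) / a\<^sup>2"
    by (rule second_moment_tail[OF assms(1,2) a])
  finally show ?thesis .
qed

lemma prob_longest_tail_vertex:
  "measure_pmf.prob (random_hypergraph r n p) {E. 2 * t + 2 \<le> longest_loose_cycle r {1..n} E \<and>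
     real n * at_least_two ((n - 1) choose (r - 1)) (branch_bound r ((n - 1) choose (r - 1)) p t) + a
       < real (longest_loose_cycle r {1..n} E)}
   \<le> real (r * r) * (\<Sum>k<2 * Suc t. real (n choose r) * p * (real r * (real ((n - 1) choose (r - 1)) * p)) ^ k) / a\<^sup>2"
proof (rule order_trans[OF prob_longest_tail])
  show "(\<Sum>u\<in>{1..n}. pr (vertex_wit (all_edges r n) t u))
      \<le> real n * at_least_two ((n - 1) choose (r - 1)) (branch_bound r ((n - 1) choose (r - 1)) p t)"
    using sum_bounded_above[of "{1..n}" "\<lambda>u. pr (vertex_wit (all_edges r n) t u)", OF pr_vertex_wit_le]
    by simp
  have "(\<Sum>i\<in>{1..n}. \<Sum>j\<in>{1..n}. pr (overlaps (vertex_wit (all_edges r n) t i) (vertex_wit (all_edges r n) t j)))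
      \<le> real (r * r) * overlap_bound (Suc t)"
    \<comment> \<open>A chain from a vertex starts with an edge containing it, so an edge serves its
      \<open>r\<close> vertices; this gives the factor \<open>r * r\<close>.\<close>
    by (rule sum_pr_overlaps_le[where \<phi> = "\<lambda>e. e"])
      (use finite_edge card_edge chain_of_vertex_wit in auto)
  then show "(\<Sum>i\<in>{1..n}. \<Sum>j\<in>{1..n}. pr (overlaps (vertex_wit (all_edges r n) t i) (vertex_wit (all_edges r n) t j))) / a\<^sup>2
    \<le> real (r * r) * (\<Sum>k<2 * Suc t. real (n choose r) * p * (real r * (real ((n - 1) choose (r - 1)) * p)) ^ k) / a\<^sup>2"
    unfolding overlap_bound_all_edges by (rule divide_right_mono) simp
qed (use longest_loose_cycle_le(1)[OF r _ finite_V finite_X] in auto)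

lemma prob_longest_tail_edge:
  "measure_pmf.prob (random_hypergraph r n p) {E. 2 * t + 2 \<le> longest_loose_cycle r {1..n} E \<and>
     real (n choose r) * (p * at_least_two r (path_bound r ((n - 1) choose (r - 1)) p t)) + a
       < real (longest_loose_cycle r {1..n} E)}
   \<le> (\<Sum>k<2 * Suc t. real (n choose r) * p * (real r * (real ((n - 1) choose (r - 1)) * p)) ^ k) / a\<^sup>2"
proof (rule order_trans[OF prob_longest_tail])
  show "(\<Sum>e\<in>all_edges r n. pr (edge_wit (all_edges r n) t e))
      \<le> real (n choose r) * (p * at_least_two r (path_bound r ((n - 1) choose (r - 1)) p t))"
    using sum_bounded_above[of "all_edges r n" "\<lambda>e. pr (edge_wit (all_edges r n) t e)", OF pr_edge_wit_le]
    by (simp add: card_all_edges)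
  have "(\<Sum>i\<in>all_edges r n. \<Sum>j\<in>all_edges r n. pr (overlaps (edge_wit (all_edges r n) t i) (edge_wit (all_edges r n) t j)))
      \<le> real (1 * 1) * overlap_bound (Suc t)"
    by (rule sum_pr_overlaps_le[where \<phi> = "\<lambda>e. {e}"])
      (use finite_X in auto, metis chain_of_edge_wit)
  then show "(\<Sum>i\<in>all_edges r n. \<Sum>j\<in>all_edges r n. pr (overlaps (edge_wit (all_edges r n) t i) (edge_wit (all_edges r n) t j))) / a\<^sup>2
    \<le> (\<Sum>k<2 * Suc t. real (n choose r) * p * (real r * (real ((n - 1) choose (r - 1)) * p)) ^ k) / a\<^sup>2"
    unfolding overlap_bound_all_edges by (intro divide_right_mono) simp_all
qed (use longest_loose_cycle_le(2)[OF r _ finite_V finite_X] finite_X in auto)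

end

section \<open>Limits\<close>

lemma tendsto_one_minus_power:
  fixes b :: "nat \<Rightarrow> real" and m :: "nat \<Rightarrow> nat"
  assumes m: "filterlim m at_top sequentially" and mb: "(\<lambda>n. real (m n) * b n) \<longlonglongrightarrow> \<mu>"
    and b: "eventually (\<lambda>n. 0 \<le> b n) sequentially"
  shows "b \<longlonglongrightarrow> 0" "(\<lambda>n. (1 - b n) ^ m n) \<longlonglongrightarrow> exp (- \<mu>)"
proof -
  have m': "filterlim (\<lambda>n. real (m n)) at_top sequentially"
    using filterlim_compose[OF filterlim_real_sequentially m] .
  have pos: "eventually (\<lambda>n. m n > 0) sequentially"
    using m[unfolded filterlim_at_top, rule_format, of 1] by eventually_elim simp
  have "(\<lambda>n. real (m n) * b n / real (m n)) \<longlonglongrightarrow> 0"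
    by (rule tendsto_divide_0[OF mb]) (use m' in \<open>rule filterlim_at_top_imp_at_infinity\<close>)
  then show b0: "b \<longlonglongrightarrow> 0"
    by (rule Lim_transform_eventually) (use pos in \<open>auto elim: eventually_mono\<close>)
  have small: "eventually (\<lambda>n. b n < 1 / 2) sequentially"
    using b0 by (rule order_tendstoD) simp
  have "(\<lambda>n. real (m n) * ln (1 - b n)) \<longlonglongrightarrow> - \<mu>"
  proof (rule tendsto_sandwich)
    \<comment> \<open>This lower bound comes from \<open>ln (1 - b) \<ge> - b - 2 * b^2\<close> on
      [0, 1/2]; its quadratic term vanishes because \<open>m * b\<close> converges and
      \<open>b\<close> tends to 0.\<close>
    show "(\<lambda>n. - (real (m n) * b n) - 2 * (real (m n) * b n) * b n) \<longlonglongrightarrow> - \<mu>"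
      using tendsto_diff[OF tendsto_minus[OF mb] tendsto_mult[OF tendsto_mult[OF tendsto_const[of 2] mb] b0]]
      by simp
    show "(\<lambda>n. - (real (m n) * b n)) \<longlonglongrightarrow> - \<mu>"
      by (rule tendsto_minus[OF mb])
    show "eventually (\<lambda>n. real (m n) * ln (1 - b n) \<le> - (real (m n) * b n)) sequentially"
      using small
    proof eventually_elim
      case (elim n)
      then have "ln (1 - b n) \<le> - b n" using ln_le_minus_one[of "1 - b n"] by simp
      then show ?case using mult_left_mono[of "ln (1 - b n)" "- b n" "real (m n)"] by simp
    qed
    show "eventually (\<lambda>n. - (real (m n) * b n) - 2 * (real (m n) * b n) * b n \<le> real (m n) * ln (1 - b n)) sequentially"
      using small b
    proof eventually_elim
      case (elim n)
      then have "- b n - 2 * (b n)\<^sup>2 \<le> ln (1 - b n)"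
        by (intro ln_one_minus_pos_lower_bound) auto
      then have "real (m n) * (- b n - 2 * (b n)\<^sup>2) \<le> real (m n) * ln (1 - b n)"
        by (intro mult_left_mono) auto
      then show ?case by (simp add: algebra_simps power2_eq_square)
    qed
  qed
  then have "(\<lambda>n. exp (real (m n) * ln (1 - b n))) \<longlonglongrightarrow> exp (- \<mu>)"
    by (rule tendsto_exp)
  then show "(\<lambda>n. (1 - b n) ^ m n) \<longlonglongrightarrow> exp (- \<mu>)"
  proof (rule Lim_transform_eventually)
    show "eventually (\<lambda>n. exp (real (m n) * ln (1 - b n)) = (1 - b n) ^ m n) sequentially"
      using small by eventually_elim (simp add: exp_of_nat_mult)
  qed
qed

text \<open>The limit is the probability that a Poisson variable with mean \<mu> is at least 2, the
  origin of the formula for \<open>gamma\<close>.\<close>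

lemma tendsto_at_least_two:
  fixes b :: "nat \<Rightarrow> real" and m :: "nat \<Rightarrow> nat"
  assumes m: "filterlim m at_top sequentially" and mb: "(\<lambda>n. real (m n) * b n) \<longlonglongrightarrow> \<mu>"
    and b: "eventually (\<lambda>n. 0 \<le> b n) sequentially"
  shows "(\<lambda>n. at_least_two (m n) (b n)) \<longlonglongrightarrow> 1 - exp (- \<mu>) - \<mu> * exp (- \<mu>)"
proof -
  note lim = tendsto_one_minus_power[OF assms]
  \<comment> \<open>The exponent \<open>m - 1\<close> is obtained by dividing by
    \<open>1 - b\<close>, which tends to 1.\<close>
  have "(\<lambda>n. (1 - b n) ^ m n / (1 - b n)) \<longlonglongrightarrow> exp (- \<mu>) / (1 - 0)"
    by (intro tendsto_divide tendsto_diff tendsto_const lim) simp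
  then have "(\<lambda>n. 1 - (1 - b n) ^ m n - real (m n) * b n * ((1 - b n) ^ m n / (1 - b n)))
      \<longlonglongrightarrow> 1 - exp (- \<mu>) - \<mu> * exp (- \<mu>)"
    by (intro tendsto_diff tendsto_mult tendsto_const lim mb) simp
  then show ?thesis
  proof (rule Lim_transform_eventually)
    have "eventually (\<lambda>n. b n < 1) sequentially"
      using lim(1) by (rule order_tendstoD) simp
    moreover have "eventually (\<lambda>n. m n > 0) sequentially"
      using m[unfolded filterlim_at_top, rule_format, of 1] by eventually_elim simp
    ultimately show "eventually (\<lambda>n. 1 - (1 - b n) ^ m n - real (m n) * b n * ((1 - b n) ^ m n / (1 - b n))
        = at_least_two (m n) (b n)) sequentially"
    proof eventually_elim
      case (elim n)
      then have "(1 - b n) ^ m n / (1 - b n) = (1 - b n) ^ (m n - 1)"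
        by (cases "m n") auto
      then show ?case by (simp only: at_least_two_def)
    qed
  qed
qed

section \<open>The limiting recursion and its largest fixed point\<close>

fun path_limit :: "nat \<Rightarrow> real \<Rightarrow> nat \<Rightarrow> real" where
  "path_limit r d 0 = 1"
| "path_limit r d (Suc t) = 1 - F r d (1 - path_limit r d t)"

lemma tendsto_path_bound:
  assumes M: "filterlim M at_top sequentially" and Mp: "(\<lambda>n. real (M n) * p n) \<longlonglongrightarrow> d"
    and p: "eventually (\<lambda>n. 0 \<le> p n \<and> p n \<le> 1) sequentially"
  shows "(\<lambda>n. path_bound r (M n) (p n) t) \<longlonglongrightarrow> path_limit r d t"
    and "(\<lambda>n. real (M n) * branch_bound r (M n) (p n) t) \<longlonglongrightarrow> d * (1 - (1 - path_limit r d t) ^ (r - 1))"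
proof -
  have branch: "(\<lambda>n. real (M n) * branch_bound r (M n) (p n) t) \<longlonglongrightarrow> d * (1 - (1 - path_limit r d t) ^ (r - 1))"
    if "(\<lambda>n. path_bound r (M n) (p n) t) \<longlonglongrightarrow> path_limit r d t" for t
    using tendsto_mult[OF Mp tendsto_diff[OF tendsto_const[of 1] tendsto_power[OF tendsto_diff[OF tendsto_const[of 1] that], of "r - 1"]]]
    by (simp add: branch_bound_def mult.assoc)
  show path: "(\<lambda>n. path_bound r (M n) (p n) t) \<longlonglongrightarrow> path_limit r d t"
  proof (induction t)
    case (Suc t)
    have "eventually (\<lambda>n. 0 \<le> branch_bound r (M n) (p n) t) sequentially"
      using p by eventually_elim (simp add: branch_bound_range)
    from tendsto_one_minus_power(2)[OF M branch[OF Suc] this]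
    have "(\<lambda>n. 1 - (1 - branch_bound r (M n) (p n) t) ^ M n)
        \<longlonglongrightarrow> 1 - exp (- (d * (1 - (1 - path_limit r d t) ^ (r - 1))))"
      by (intro tendsto_diff tendsto_const)
    then show ?case by (simp add: branch_bound_def F_def)
  qed simp
  show "(\<lambda>n. real (M n) * branch_bound r (M n) (p n) t) \<longlonglongrightarrow> d * (1 - (1 - path_limit r d t) ^ (r - 1))"
    by (rule branch[OF path])
qed

lemma F_mono:
  assumes "0 \<le> d" "0 \<le> x" "x \<le> y"
  shows "F r d x \<le> F r d y"
proof -
  have "x ^ (r - 1) \<le> y ^ (r - 1)" using assms by (intro power_mono) auto
  then have "d * (1 - y ^ (r - 1)) \<le> d * (1 - x ^ (r - 1))" using assms by (intro mult_left_mono) auto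
  then show ?thesis by (simp add: F_def)
qed

lemma rho_star_range:
  assumes "0 \<le> d"
  shows "0 \<le> rho_star r d" "rho_star r d \<le> 1"
proof -
  show "0 \<le> rho_star r d" by (rule rho_star_greatest(2)) (auto simp: F_def)
  have "0 < 1 - rho_star r d"
    by (subst rho_star_greatest(1)) (simp add: F_def)
  then show "rho_star r d \<le> 1" by simp
qed

text \<open>The iteration of a monotone map starts at 1, above every admissible fixed point, so it
  decreases and stays above \<open>rho_star\<close>. Its limit is a fixed point, hence at most the
  largest one.\<close>

lemma path_limit_tendsto:
  assumes "0 \<le> d"
  shows "path_limit r d \<longlonglongrightarrow> rho_star r d"
proof -
  let ?q = "\<lambda>t. 1 - path_limit r d t"
  have ge: "rho_star r d \<le> path_limit r d t" for t
  proof (induction t)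
    case (Suc t)
    have range: "path_limit r d t \<le> 1"
      by (cases t) (simp_all add: F_def)
    have "1 - path_limit r d (Suc t) = F r d (1 - path_limit r d t)" by simp
    also have "\<dots> \<le> F r d (1 - rho_star r d)"
      using Suc range assms by (intro F_mono) auto
    also have "\<dots> = 1 - rho_star r d" by (rule rho_star_greatest(1)[symmetric])
    finally show ?case by simp
  qed (simp add: rho_star_range assms)
  have le1: "path_limit r d t \<le> 1" for t
    by (cases t) (simp_all add: F_def)
  have "path_limit r d (Suc t) \<le> path_limit r d t" for t
  proof (induction t)
    case (Suc t)
    have "F r d (1 - path_limit r d t) \<le> F r d (1 - path_limit r d (Suc t))"
      using Suc le1[of t] assms by (intro F_mono) auto
    then show ?case by simp
  qed (simp add: F_def)
  then have "decseq (path_limit r d)" by (rule decseq_SucI)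
  then obtain L where L: "path_limit r d \<longlonglongrightarrow> L"
    using decseq_convergent[of "path_limit r d" "rho_star r d"] ge by blast
  have "(\<lambda>t. 1 - F r d (1 - path_limit r d t)) \<longlonglongrightarrow> 1 - F r d (1 - L)"
    unfolding F_def by (intro tendsto_intros L)
  moreover have "(\<lambda>t. path_limit r d (Suc t)) \<longlonglongrightarrow> L"
    using L by (rule LIMSEQ_Suc)
  ultimately have "L = 1 - F r d (1 - L)"
    by (auto intro: LIMSEQ_unique)
  \<comment> \<open>The maximality of \<open>rho_star\<close> only concerns solutions with
    \<open>1 - \<rho> \<ge> 0\<close>.\<close>
  moreover have "L \<le> 1" by (rule LIMSEQ_le_const2[OF L]) (use le1 in auto)
  ultimately have "L \<le> rho_star r d" by (intro rho_star_greatest(2)) auto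
  moreover have "rho_star r d \<le> L" by (rule LIMSEQ_le_const[OF L]) (use ge in auto)
  ultimately show ?thesis using L by simp
qed

lemma filterlim_binomial_at_top:
  assumes "k \<ge> 1"
  shows "filterlim (\<lambda>n. (n - 1) choose k) at_top sequentially"
proof (rule filterlim_at_top_mono)
  show "filterlim (\<lambda>n. n - 1 - k + 1) at_top sequentially"
    by (rule filterlim_at_top_mono[OF filterlim_minus_const_nat_at_top[of "k + 1"]]) auto
  show "eventually (\<lambda>n. n - 1 - k + 1 \<le> (n - 1) choose k) sequentially"
    using eventually_ge_at_top[of "k + 1"]
  proof eventually_elim
    case (elim n)
    have "m + 1 \<le> (m + k) choose k" for m
    proof (induction m)
      case (Suc m)
      have "Suc m + k choose k = (m + k choose k) + (m + k choose (k - 1))"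
        using assms by (cases k) auto
      moreover have "(m + k choose (k - 1)) > 0" by simp
      ultimately show ?case using Suc by linarith
    qed simp
    from this[of "n - 1 - k"] elim show ?case by simp
  qed
qed

section \<open>From fixed errors to a vanishing error sequence\<close>

lemma exists_error_sequence:
  fixes Y :: "nat \<Rightarrow> 'a \<Rightarrow> real" and M :: "nat \<Rightarrow> 'a pmf" and c :: real
  assumes "\<And>\<epsilon>. \<epsilon> > 0 \<Longrightarrow> (\<lambda>n. measure_pmf.prob (M n) {x. Y n x \<le> (c + \<epsilon>) * real n}) \<longlonglongrightarrow> 1"
  shows "\<exists>\<epsilon>. \<epsilon> \<longlonglongrightarrow> 0 \<and> (\<lambda>n. measure_pmf.prob (M n) {x. Y n x \<le> (c + \<epsilon> n) * real n}) \<longlonglongrightarrow> 1"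
proof -
  let ?P = "\<lambda>n \<epsilon>. measure_pmf.prob (M n) {x. Y n x \<le> (c + \<epsilon>) * real n}"
  \<comment> \<open>The same number serves as error and as bound for the failure probability, as in
    the Ky Fan metric. One sequence then controls both, and 1 is always allowed.\<close>
  define S where "S n = {\<epsilon>. 0 \<le> \<epsilon> \<and> 1 - \<epsilon> \<le> ?P n \<epsilon>}" for n
  define \<delta> where "\<delta> n = Inf (S n)" for n
  \<comment> \<open>The infimum may not be attained; a vanishing positive amount moves above
    it.\<close>
  define \<epsilon> where "\<epsilon> n = \<delta> n + 1 / real (Suc n)" for n
  have bdd: "bdd_below (S n)" for n by (rule bdd_belowI[of _ 0]) (simp add: S_def)
  have ne: "1 \<in> S n" for n by (simp add: S_def)
  have \<delta>0: "0 \<le> \<delta> n" for n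
    unfolding \<delta>_def by (intro cInf_greatest) (use ne[of n] in blast, auto simp: S_def)
  have "\<delta> \<longlonglongrightarrow> 0"
  proof (rule LIMSEQ_I)
    fix e :: real assume e: "e > 0"
    have "eventually (\<lambda>n. 1 - e / 2 < ?P n (e / 2)) sequentially"
      using e by (intro order_tendstoD(1)[OF assms]) auto
    then have "eventually (\<lambda>n. \<delta> n \<le> e / 2) sequentially"
    proof eventually_elim
      case (elim n)
      then show ?case unfolding \<delta>_def using bdd e by (intro cInf_lower) (auto simp: S_def)
    qed
    then show "\<exists>N. \<forall>n\<ge>N. norm (\<delta> n - 0) < e"
      using \<delta>0 e unfolding eventually_sequentially by fastforce
  qed
  then have \<epsilon>0: "\<epsilon> \<longlonglongrightarrow> 0"
    unfolding \<epsilon>_def using tendsto_add[OF _ LIMSEQ_Suc[OF lim_1_over_n]] by fastforce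
  have lower: "1 - \<epsilon> n \<le> ?P n (\<epsilon> n)" for n
  proof -
    have "\<exists>\<eta>\<in>S n. \<eta> < \<epsilon> n"
      unfolding \<epsilon>_def \<delta>_def using ne by (intro cInf_lessD) auto
    then obtain \<eta> where \<eta>: "1 - \<eta> \<le> ?P n \<eta>" "\<eta> < \<epsilon> n" by (auto simp: S_def)
    have "?P n \<eta> \<le> ?P n (\<epsilon> n)"
    proof (intro measure_pmf.finite_measure_mono subsetI CollectI)
      fix x assume "x \<in> {x. Y n x \<le> (c + \<eta>) * real n}"
      moreover have "(c + \<eta>) * real n \<le> (c + \<epsilon> n) * real n"
        using \<eta> by (intro mult_right_mono) auto
      ultimately show "Y n x \<le> (c + \<epsilon> n) * real n" by simp
    qed simp
    with \<eta> show ?thesis by linarith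
  qed
  have "(\<lambda>n. ?P n (\<epsilon> n)) \<longlonglongrightarrow> 1"
  proof (rule tendsto_sandwich)
    show "(\<lambda>n. 1 - \<epsilon> n) \<longlonglongrightarrow> 1" using tendsto_diff[OF tendsto_const[of 1] \<epsilon>0] by simp
    show "eventually (\<lambda>n. 1 - \<epsilon> n \<le> ?P n (\<epsilon> n)) sequentially" using lower by simp
    show "eventually (\<lambda>n. ?P n (\<epsilon> n) \<le> 1) sequentially" by simp
  qed simp
  with \<epsilon>0 show ?thesis by blast
qed

text \<open>First \<open>t\<close> is chosen so that the limiting mean is close to \<open>b\<close>,
  then \<open>n\<close> grows with this \<open>t\<close> and its constant \<open>C\<close>. A
  deviation of order \<open>n\<close> against a bound of order \<open>n\<close> leaves a failure
  probability of order \<open>1 / n\<close>.\<close>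

lemma prob_longest_tendsto:
  fixes B :: "nat \<Rightarrow> nat \<Rightarrow> real" and Q :: "nat \<Rightarrow> nat set set pmf"
  assumes "r \<ge> 3" "0 \<le> b" "B' \<longlonglongrightarrow> b" "\<And>t. B t \<longlonglongrightarrow> B' t"
    and tail: "\<And>t. \<exists>C. eventually (\<lambda>n. \<forall>a>0. measure_pmf.prob (Q n)
        {E. 2 * t + 2 \<le> longest_loose_cycle r {1..n} E \<and>
            real n * B t n + a < real (longest_loose_cycle r {1..n} E)} \<le> C * real n / a\<^sup>2) sequentially"
    and "\<epsilon> > 0"
  shows "(\<lambda>n. measure_pmf.prob (Q n) {E. real (longest_loose_cycle r {1..n} E) \<le> (b + \<epsilon>) * real n}) \<longlonglongrightarrow> 1"
proof -
  let ?L = "\<lambda>n E. longest_loose_cycle r {1..n} E"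
  have "eventually (\<lambda>t. B' t < b + \<epsilon> / 4) sequentially"
    using assms(3,6) by (intro order_tendstoD(2)[OF assms(3)]) auto
  then obtain t where t: "B' t < b + \<epsilon> / 4"
    using eventually_happens'[OF sequentially_bot] by blast
  have "B' t < b + \<epsilon> / 2" using t assms(6) by simp
  from order_tendstoD(2)[OF assms(4) this]
  have Bn: "eventually (\<lambda>n. B t n < b + \<epsilon> / 2) sequentially" .
  obtain C where C: "eventually (\<lambda>n. \<forall>a>0. measure_pmf.prob (Q n)
        {E. 2 * t + 2 \<le> ?L n E \<and> real n * B t n + a < real (?L n E)} \<le> C * real n / a\<^sup>2) sequentially"
    using tail by blast
  have large: "eventually (\<lambda>n. real (2 * t + 2) / \<epsilon> < real n) sequentially"
    using filterlim_real_sequentially by (auto simp: filterlim_at_top_dense)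
  have "eventually (\<lambda>n. 1 - 4 * C / \<epsilon>\<^sup>2 * (1 / real n) \<le>
      measure_pmf.prob (Q n) {E. real (?L n E) \<le> (b + \<epsilon>) * real n}) sequentially"
    using Bn C large eventually_gt_at_top[of 0]
  proof eventually_elim
    case (elim n)
    let ?A = "{E. real (?L n E) \<le> (b + \<epsilon>) * real n}"
    \<comment> \<open>Half of the error absorbs the mean, the other half is the deviation.\<close>
    let ?a = "\<epsilon> / 2 * real n"
    have "- ?A \<subseteq> {E. 2 * t + 2 \<le> ?L n E \<and> real n * B t n + ?a < real (?L n E)}"
    proof
      fix E assume "E \<in> - ?A"
      then have L: "(b + \<epsilon>) * real n < real (?L n E)" by simp
      \<comment> \<open>A cycle that violates the bound is automatically long enough for the local
        property at depth \<open>t\<close>.\<close>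
      have "real (2 * t + 2) < \<epsilon> * real n" using elim(3) assms(6) by (simp add: field_simps)
      also have "\<dots> \<le> (b + \<epsilon>) * real n" using assms(2) by (intro mult_right_mono) auto
      finally have "real (2 * t + 2) < real (?L n E)" using L by linarith
      moreover have "real n * B t n \<le> real n * (b + \<epsilon> / 2)"
        using elim(1) by (intro mult_left_mono) auto
      then have "real n * B t n + ?a \<le> (b + \<epsilon>) * real n" by (simp add: algebra_simps)
      ultimately show "E \<in> {E. 2 * t + 2 \<le> ?L n E \<and> real n * B t n + ?a < real (?L n E)}"
        using L by simp
    qed
    then have "measure_pmf.prob (Q n) (- ?A) \<le>
        measure_pmf.prob (Q n) {E. 2 * t + 2 \<le> ?L n E \<and> real n * B t n + ?a < real (?L n E)}"
      by (intro measure_pmf.finite_measure_mono) auto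
    also have "\<dots> \<le> C * real n / ?a\<^sup>2" using elim(2,4) assms(6) by simp
    also have "\<dots> = 4 * C / \<epsilon>\<^sup>2 * (1 / real n)"
      using elim(4) assms(6) by (simp add: field_simps power2_eq_square)
    finally show ?case
      using measure_pmf.prob_compl[of ?A "Q n"] by (simp add: Compl_eq_Diff_UNIV)
  qed
  moreover have "(\<lambda>n. 1 - 4 * C / \<epsilon>\<^sup>2 * (1 / real n)) \<longlonglongrightarrow> 1 - 4 * C / \<epsilon>\<^sup>2 * 0"
    by (intro tendsto_diff tendsto_mult tendsto_const lim_1_over_n)
  then have "(\<lambda>n. 1 - 4 * C / \<epsilon>\<^sup>2 * (1 / real n)) \<longlonglongrightarrow> 1" by simp
  ultimately show ?thesis
    by (rule tendsto_sandwich[OF _ always_eventually[OF allI[OF measure_pmf.prob_le_1]] _ tendsto_const])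
qed

theorem theorem1p6:
  fixes r :: nat and d :: real and dn :: "nat \<Rightarrow> real" and p :: "nat \<Rightarrow> real"
  assumes "r \<ge> 3"
    and "d > 0"
    and "dn \<longlonglongrightarrow> d"
    and "\<And>n. p n = dn n / real ((n - 1) choose (r - 1))"
  shows "\<exists>\<epsilon> :: nat \<Rightarrow> real. \<epsilon> \<longlonglongrightarrow> 0 \<and>
    (\<lambda>n. measure_pmf.prob (random_hypergraph r n (p n))
           {E. real (longest_loose_cycle r {1..n} E) \<le> (min (beta r d) (gamma r d) + \<epsilon> n) * real n})
      \<longlonglongrightarrow> 1"
proof (rule exists_error_sequence)
  fix \<epsilon> :: real assume \<epsilon>: "\<epsilon> > 0"
  define M where "M n = ((n - 1) choose (r - 1))" for n
  have M: "filterlim M at_top sequentially"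
    unfolding M_def using assms(1) by (intro filterlim_binomial_at_top) auto
  have M_pos: "eventually (\<lambda>n. 0 < M n) sequentially"
    using M[unfolded filterlim_at_top, rule_format, of 1] by eventually_elim simp
  have Mp_eq: "eventually (\<lambda>n. real (M n) * p n = dn n) sequentially"
    using M_pos by eventually_elim (simp add: assms(4) M_def)
  have Mp: "(\<lambda>n. real (M n) * p n) \<longlonglongrightarrow> d"
    by (rule Lim_transform_eventually[OF assms(3)]) (use Mp_eq in \<open>auto elim: eventually_mono\<close>)
  \<comment> \<open>Positivity gives \<open>p n \<ge> 0\<close>; the bound \<open>d + 1\<close>
    yields constants independent of \<open>n\<close>.\<close>
  have dn_range: "eventually (\<lambda>n. 0 < dn n \<and> dn n < d + 1) sequentially"
    using order_tendstoD[OF assms(3)] assms(2) by (simp add: eventually_conj)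
  have "eventually (\<lambda>n. 0 \<le> p n) sequentially"
    using dn_range by eventually_elim (simp add: assms(4))
  moreover from this have "p \<longlonglongrightarrow> 0" using tendsto_one_minus_power(1)[OF M Mp] by simp
  then have "eventually (\<lambda>n. p n < 1) sequentially" by (rule order_tendstoD) simp
  ultimately have p_range: "eventually (\<lambda>n. 0 \<le> p n \<and> p n \<le> 1) sequentially"
    by eventually_elim simp
  \<comment> \<open>Counting incidences of vertices and edges in two ways; this is where the factor
    \<open>d / r\<close> of \<open>beta\<close> comes from.\<close>
  have edges_p: "eventually (\<lambda>n. real (n choose r) * p n = real n * (dn n / real r)) sequentially"
    using Mp_eq
  proof eventually_elim
    case (elim n)
    have "r * (n choose r) = n * M n"
      unfolding M_def using assms(1) by (intro times_binomial_minus1_eq) simp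
    then have "real r * real (n choose r) = real n * real (M n)"
      by (metis of_nat_mult)
    then have "real (n choose r) = real n * real (M n) / real r"
      using assms(1) by (simp add: field_simps)
    then show ?case using elim by (metis mult.assoc times_divide_eq_left times_divide_eq_right)
  qed
  \<comment> \<open>The bound on overlaps with \<open>dn n\<close> replaced by \<open>d + 1\<close>
    and the factor \<open>n\<close> taken out.\<close>
  define C where "C t = (d + 1) / real r * (\<Sum>k<2 * Suc t. (real r * (d + 1)) ^ k)" for t
  have overlap: "eventually (\<lambda>n. (\<Sum>k<2 * Suc t. real (n choose r) * p n * (real r * (real ((n - 1) choose (r - 1)) * p n)) ^ k)
      \<le> C t * real n) sequentially" for t
    using edges_p Mp_eq dn_range
  proof eventually_elim
    case (elim n)
    have "(\<Sum>k<2 * Suc t. real (n choose r) * p n * (real r * (real ((n - 1) choose (r - 1)) * p n)) ^ k)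
        = (\<Sum>k<2 * Suc t. real n * (dn n / real r) * (real r * dn n) ^ k)"
      using elim(1,2) unfolding M_def by simp
    also have "\<dots> \<le> (\<Sum>k<2 * Suc t. real n * ((d + 1) / real r) * (real r * (d + 1)) ^ k)"
      using elim(3) assms(2)
      by (intro sum_mono mult_mono power_mono divide_right_mono) auto
    also have "\<dots> = C t * real n"
      unfolding C_def sum_distrib_left sum_distrib_right by (simp only: mult_ac)
    finally show ?case .
  qed

  have rho: "0 \<le> rho_star r d" "rho_star r d \<le> 1"
    using rho_star_range assms(2) by auto
  have path: "(\<lambda>n. path_bound r (M n) (p n) t) \<longlonglongrightarrow> path_limit r d t"
    and branch: "(\<lambda>n. real (M n) * branch_bound r (M n) (p n) t) \<longlonglongrightarrow> d * (1 - (1 - path_limit r d t) ^ (r - 1))" for t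
    using tendsto_path_bound[OF M Mp p_range] by auto
  have path_lim: "path_limit r d \<longlonglongrightarrow> rho_star r d"
    using assms(2) by (intro path_limit_tendsto) simp

  have beta_eq: "beta r d = d / real r * at_least_two r (rho_star r d)"
    by (simp add: beta_def at_least_two_def)
  have beta: "(\<lambda>n. measure_pmf.prob (random_hypergraph r n (p n))
      {E. real (longest_loose_cycle r {1..n} E) \<le> (beta r d + \<epsilon>) * real n}) \<longlonglongrightarrow> 1"
  proof (rule prob_longest_tendsto[OF assms(1) _ _ _ _ \<epsilon>])
    show "0 \<le> beta r d"
      unfolding beta_eq using assms(2) rho by (intro mult_nonneg_nonneg at_least_two_nonneg) auto
    show "(\<lambda>t. d / real r * at_least_two r (path_limit r d t)) \<longlonglongrightarrow> beta r d"
      unfolding beta_eq at_least_two_def by (intro tendsto_intros path_lim)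
    show "(\<lambda>n. dn n / real r * at_least_two r (path_bound r (M n) (p n) t))
        \<longlonglongrightarrow> d / real r * at_least_two r (path_limit r d t)" for t
      unfolding at_least_two_def divide_inverse by (intro tendsto_intros path assms(3))
    show "\<exists>C. eventually (\<lambda>n. \<forall>a>0. measure_pmf.prob (random_hypergraph r n (p n))
        {E. 2 * t + 2 \<le> longest_loose_cycle r {1..n} E \<and>
            real n * (dn n / real r * at_least_two r (path_bound r (M n) (p n) t)) + a
              < real (longest_loose_cycle r {1..n} E)} \<le> C * real n / a\<^sup>2) sequentially" for t
    proof (rule exI[of _ "C t"], use overlap[of t] edges_p p_range in eventually_elim)
      case (elim n)
      show ?case
      proof (intro allI impI)
        fix a :: real assume a: "0 < a"
        have "real (n choose r) * (p n * at_least_two r (path_bound r (M n) (p n) t))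
            = real n * (dn n / real r * at_least_two r (path_bound r (M n) (p n) t))"
          by (simp only: mult.assoc[symmetric] elim(2))
        with prob_longest_tail_edge[of "p n" r a n t] elim(3) assms(1) a
        have "measure_pmf.prob (random_hypergraph r n (p n))
          {E. 2 * t + 2 \<le> longest_loose_cycle r {1..n} E \<and>
            real n * (dn n / real r * at_least_two r (path_bound r (M n) (p n) t)) + a
              < real (longest_loose_cycle r {1..n} E)} \<le>
          (\<Sum>k<2 * Suc t. real (n choose r) * p n * (real r * (real ((n - 1) choose (r - 1)) * p n)) ^ k) / a\<^sup>2"
          unfolding M_def by simp
        also have "\<dots> \<le> C t * real n / a\<^sup>2"
          by (intro divide_right_mono elim(1)) simp
        finally show "measure_pmf.prob (random_hypergraph r n (p n))
          {E. 2 * t + 2 \<le> longest_loose_cycle r {1..n} E \<and>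
            real n * (dn n / real r * at_least_two r (path_bound r (M n) (p n) t)) + a
              < real (longest_loose_cycle r {1..n} E)} \<le> C t * real n / a\<^sup>2" .
      qed
    qed
  qed

  have gamma: "(\<lambda>n. measure_pmf.prob (random_hypergraph r n (p n))
      {E. real (longest_loose_cycle r {1..n} E) \<le> (gamma r d + \<epsilon>) * real n}) \<longlonglongrightarrow> 1"
  proof (rule prob_longest_tendsto[OF assms(1) _ _ _ _ \<epsilon>])
    let ?\<mu> = "\<lambda>\<rho>. d * (1 - (1 - \<rho>) ^ (r - 1))"
    let ?g = "\<lambda>\<mu>. 1 - exp (- \<mu>) - \<mu> * exp (- \<mu>) :: real"
    have gamma_eq: "gamma r d = ?g (?\<mu> (rho_star r d))"
      by (simp add: gamma_def rho_hat_star_def)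
    \<comment> \<open>\<open>gamma\<close> is nonnegative because
      \<open>exp \<mu> \<ge> 1 + \<mu>\<close>.\<close>
    have "(1 + \<mu>) * exp (- \<mu>) \<le> exp \<mu> * exp (- \<mu>)" for \<mu> :: real
      by (intro mult_right_mono) auto
    then have "0 \<le> ?g \<mu>" for \<mu> :: real
      by (simp add: algebra_simps flip: exp_add)
    then show "0 \<le> gamma r d" unfolding gamma_eq .
    show "(\<lambda>t. ?g (?\<mu> (path_limit r d t))) \<longlonglongrightarrow> gamma r d"
      unfolding gamma_eq by (intro tendsto_intros path_lim)
    show "(\<lambda>n. at_least_two (M n) (branch_bound r (M n) (p n) t)) \<longlonglongrightarrow> ?g (?\<mu> (path_limit r d t))" for t
      using p_range by (intro tendsto_at_least_two M branch) (auto elim!: eventually_mono intro: branch_bound_range)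
    show "\<exists>C. eventually (\<lambda>n. \<forall>a>0. measure_pmf.prob (random_hypergraph r n (p n))
        {E. 2 * t + 2 \<le> longest_loose_cycle r {1..n} E \<and>
            real n * at_least_two (M n) (branch_bound r (M n) (p n) t) + a
              < real (longest_loose_cycle r {1..n} E)} \<le> C * real n / a\<^sup>2) sequentially" for t
    proof (rule exI[of _ "real (r * r) * C t"], use overlap[of t] p_range in eventually_elim)
      case (elim n)
      show ?case
      proof (intro allI impI)
        fix a :: real assume a: "0 < a"
        have "measure_pmf.prob (random_hypergraph r n (p n))
          {E. 2 * t + 2 \<le> longest_loose_cycle r {1..n} E \<and>
            real n * at_least_two (M n) (branch_bound r (M n) (p n) t) + a
              < real (longest_loose_cycle r {1..n} E)} \<le> real (r * r) *
          (\<Sum>k<2 * Suc t. real (n choose r) * p n * (real r * (real ((n - 1) choose (r - 1)) * p n)) ^ k) / a\<^sup>2"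
          unfolding M_def using elim(2) assms(1) a by (intro prob_longest_tail_vertex) auto
        also have "\<dots> \<le> real (r * r) * (C t * real n) / a\<^sup>2"
          by (intro divide_right_mono mult_left_mono elim(1)) auto
        finally show "measure_pmf.prob (random_hypergraph r n (p n))
          {E. 2 * t + 2 \<le> longest_loose_cycle r {1..n} E \<and>
            real n * at_least_two (M n) (branch_bound r (M n) (p n) t) + a
              < real (longest_loose_cycle r {1..n} E)} \<le> real (r * r) * C t * real n / a\<^sup>2"
          by (simp add: mult.assoc)
      qed
    qed
  qed

  show "(\<lambda>n. measure_pmf.prob (random_hypergraph r n (p n))
      {E. real (longest_loose_cycle r {1..n} E) \<le> (min (beta r d) (gamma r d) + \<epsilon>) * real n}) \<longlonglongrightarrow> 1"
    \<comment> \<open>The minimum is one of the two constants, so one of the two limits is already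
      the claim.\<close>
    using beta gamma by (simp add: min_def)
qed

end
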